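(* Let $P_2\approx 1.38$ denote the second smallest Pisot number. Then $L^1(\sqrt{P_2})=0$.
   Context: A Pisot number is a real algebraic integer $>1$ all of whose other algebraic conjugates have modulus strictly less than one. The set of Pisot numbers has a smallest element $P_1\approx 1.32$ and a second smallest element $P_2\approx 1.38$. For a real number $q>1$, let $X^1(q)=\left\{\sum_{i=0}^n s_iq^i : n\in\{0,1,2,\ldots\},\ s_i\in\{0,1\}\right\}$. This is an unbounded set of nonnegative reals having only finitely many elements in each bounded interval, so its elements can be arranged into a strictly increasing sequence $0=x_0^1(q)<x_1^1(q)<x_2^1(q)<\cdots$. Define $L^1(q)=\limsup_{k\to\infty}(x_{k+1}^1(q)-x_k^1(q))$. *)

theory Defs
  imports "HOL-Analysis.Analysis"
begin

definition minimal_polynomial :: "rat poly \<Rightarrow> complex \<Rightarrow> bool" where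
  "minimal_polynomial p z \<longleftrightarrow>
     lead_coeff p = 1 \<and> irreducible p \<and> poly (map_poly of_rat p) z = 0"

definition algebraic_conjugate :: "complex \<Rightarrow> complex \<Rightarrow> bool" where
  "algebraic_conjugate z w \<longleftrightarrow>
     (\<exists>p. minimal_polynomial p z \<and> poly (map_poly of_rat p) w = 0)"

definition Pisot :: "real \<Rightarrow> bool" where
  "Pisot x \<longleftrightarrow> algebraic_int x \<and> x > 1 \<and>
     (\<forall>w. algebraic_conjugate (of_real x) w \<and> w \<noteq> of_real x \<longrightarrow> norm w < 1)"

text \<open>
  The order on the reals is not well-founded, so the two least elements below are meaningful
  only because of the theorem that the set of Pisot numbers has a smallest and a second
  smallest element.
\<close>

definition smallest_Pisot :: real where
  "smallest_Pisot = (LEAST x. Pisot x)"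

definition second_smallest_Pisot :: real where
  "second_smallest_Pisot = (LEAST x. Pisot x \<and> x \<noteq> smallest_Pisot)"

definition X1 :: "real \<Rightarrow> real set" where
  "X1 q = {\<Sum>i\<le>n. s i * q ^ i | (n :: nat) s. \<forall>i\<le>n. s i \<in> {0, 1}}"

text \<open>
  For \<open>q > 1\<close> the description is uniquely satisfied, see \<open>x1_enumerates\<close> below.
\<close>

definition x1 :: "real \<Rightarrow> nat \<Rightarrow> real" where
  "x1 q = (THE x. strict_mono x \<and> range x = X1 q)"

definition L1 :: "real \<Rightarrow> ereal" where
  "L1 q = limsup (\<lambda>k. ereal (x1 q (Suc k) - x1 q k))"

lemma finite_X1_atMost:
  assumes "q > 1"
  shows "finite {y \<in> X1 q. y \<le> b}"
proof -
  obtain N where N: "b < q ^ N"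
    using real_arch_pow[OF assms] by blast
  let ?F = "(\<lambda>s. \<Sum>i<N. s i * q ^ i) ` PiE {..<N} (\<lambda>_. {0, 1})"
  have "y \<in> ?F" if y: "y \<in> X1 q" "y \<le> b" for y
  proof -
    from y(1) obtain n s where s: "y = (\<Sum>i\<le>n. s i * q ^ i)" "\<forall>i\<le>n. s i \<in> {0, 1 :: real}"
      unfolding X1_def by auto
    have large: "s i = 0" if i: "i \<le> n" "N \<le> i" for i
    proof (rule ccontr)
      assume "s i \<noteq> 0"
      with s(2) i have "s i = 1" by auto
      have "q ^ N \<le> q ^ i" using assms i by (simp add: power_increasing)
      also have "\<dots> = s i * q ^ i" using \<open>s i = 1\<close> by simp
      also have "\<dots> \<le> y" unfolding s(1)
        by (rule member_le_sum) (use s(2) i assms in force)+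
      finally show False using y(2) N by simp
    qed
    define t where "t = restrict (\<lambda>i. if i \<le> n then s i else 0) {..<N}"
    have "(\<Sum>i<N. t i * q ^ i) = (\<Sum>i\<in>{..<N} \<inter> {..n}. s i * q ^ i)"
      unfolding t_def by (rule sum.mono_neutral_cong_right) auto
    also have "\<dots> = y" unfolding s(1)
      by (rule sum.mono_neutral_cong_left) (use large in \<open>auto simp: not_less\<close>)
    finally have "y = (\<Sum>i<N. t i * q ^ i)" by simp
    moreover have "t \<in> PiE {..<N} (\<lambda>_. {0, 1})"
      unfolding t_def using s(2) by auto
    ultimately show ?thesis by blast
  qed
  then have "{y \<in> X1 q. y \<le> b} \<subseteq> ?F" by blast
  then show ?thesis by (rule finite_subset) (intro finite_imageI finite_PiE, auto)
qed

lemma infinite_X1: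
  assumes "q > 1"
  shows "infinite (X1 q)"
proof -
  have "q ^ n \<in> X1 q" for n
  proof -
    have "q ^ n = (\<Sum>i\<le>n. (if i = n then 1 else 0) * q ^ i)"
      using sum.delta[of "{..n}" n "\<lambda>i. q ^ i"] by (simp add: if_distribR if_distrib[of "\<lambda>c. c * _"] cong: if_cong)
    then show ?thesis unfolding X1_def
      by (intro CollectI exI[of _ n] exI[of _ "\<lambda>i. if i = n then 1 else 0"]) auto
  qed
  moreover have "inj (\<lambda>n. q ^ n)" using assms by (auto intro!: injI)
  ultimately show ?thesis
    by (meson image_subsetI infinite_super range_inj_infinite)
qed

lemma x1_enumerates:
  assumes "q > 1"
  shows "strict_mono (x1 q)" "range (x1 q) = X1 q"
proof -
  define N where "N y = card {z \<in> X1 q. z < y}" for y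
  have fin: "finite {z \<in> X1 q. z < y}" for y
    by (rule finite_subset[OF _ finite_X1_atMost[OF assms, of y]]) auto
  have mono: "N y < N z" if "y \<in> X1 q" "y < z" for y z
    unfolding N_def by (rule psubset_card_mono[OF fin]) (use that in force)
  have inj: "inj_on N (X1 q)"
    by (rule inj_onI) (metis less_irrefl linorder_neqE mono)
  have down: "{..<N y} \<subseteq> N ` X1 q" if "y \<in> X1 q" for y
  proof -
    have "N ` {z \<in> X1 q. z < y} \<subseteq> {..<N y}" using mono by auto
    moreover have "card (N ` {z \<in> X1 q. z < y}) = N y"
      unfolding N_def[of y] by (rule card_image) (rule inj_on_subset[OF inj], auto)
    ultimately have "N ` {z \<in> X1 q. z < y} = {..<N y}"
      by (intro card_subset_eq) auto
    then show ?thesis by blast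
  qed
  have surj: "N ` X1 q = UNIV"
  proof -
    have "infinite (N ` X1 q)" using infinite_X1[OF assms] finite_imageD[OF _ inj] by blast
    then have "\<exists>y\<in>X1 q. n < N y" for n
      by (metis (no_types, lifting) image_iff infinite_nat_iff_unbounded)
    then show ?thesis using down by blast
  qed
  define x where "x = inv_into (X1 q) N"
  have xin: "x n \<in> X1 q" and Nx: "N (x n) = n" for n
    unfolding x_def using surj by (auto intro: inv_into_into f_inv_into_f)
  have "strict_mono x"
  proof (rule strict_monoI)
    fix m n :: nat assume "m < n"
    then show "x m < x n" using mono[OF xin, of n "x m"] Nx[of m] Nx[of n]
      by (cases "x m" "x n" rule: linorder_cases) auto
  qed
  moreover have "range x = X1 q"
  proof
    show "range x \<subseteq> X1 q" using xin by blast
    show "X1 q \<subseteq> range x"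
    proof
      fix z assume "z \<in> X1 q"
      then have "z = x (N z)" unfolding x_def using inv_into_f_f[OF inj] by simp
      then show "z \<in> range x" by (rule range_eqI)
    qed
  qed
  moreover have "y = x" if y: "strict_mono y" "range y = X1 q" for y
  proof
    fix n
    have "{z \<in> X1 q. z < y n} = y ` {..<n}"
      unfolding y(2)[symmetric] using strict_mono_less[OF y(1)] by auto
    then have "N (y n) = n" unfolding N_def
      using card_image[OF inj_on_subset[OF strict_mono_imp_inj_on[OF y(1)] subset_UNIV]] by simp
    then show "y n = x n" using inj Nx[of n] xin[of n] y(2) by (metis inj_onD rangeI)
  qed
  ultimately have "\<exists>!x :: nat \<Rightarrow> real. strict_mono x \<and> range x = X1 q" by blast
  from theI'[OF this] show "strict_mono (x1 q)" "range (x1 q) = X1 q"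
    unfolding x1_def by auto
qed

end

theory Submission
  imports Defs
    "HOL-Computational_Algebra.Field_as_Ring"
    "HOL-Computational_Algebra.Polynomial_Factorial"
    "HOL-Computational_Algebra.Fundamental_Theorem_Algebra"
    "HOL-Complex_Analysis.Complex_Analysis"
begin

text \<open>
  Let \<open>\<beta>\<close> be a Pisot number with \<open>\<beta>\<^sup>2 \<le> 2\<close> whose square root \<open>q\<close> is not a Pisot number. Then \<open>- q\<close> is a
  conjugate of \<open>q\<close>, so the sums \<open>a + q b\<close> with \<open>a\<close>, \<open>b\<close> in the spectrum of \<open>q ^ 4\<close> are pairwise distinct.
  As \<open>q ^ 4 \<le> 2\<close>, this spectrum has gaps at most 1, and the pigeonhole principle gives arbitrarily small
  differences of sums of powers of \<open>q\<close> with exponents congruent to 0 or 1 modulo 4. Such differences, shifted to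
  disjoint exponents, produce sums that are \<open>\<epsilon>\<close>-dense in a long interval; adding sums of powers with
  exponents congruent to 2 modulo 4, which have bounded gaps, makes the spectrum of \<open>q\<close> eventually
  \<open>\<epsilon>\<close>-dense.

  The hypotheses are checked by identifying the two smallest Pisot numbers as in Siegel's work. If \<open>P\<close> is
  the minimal polynomial of a Pisot number \<open>\<theta>\<close> and \<open>Q\<close> is its reciprocal, then \<open>f = \<plusminus>P / Q\<close> has an integer power
  series, modulus 1 on the unit circle and the single pole \<open>1 / \<theta>\<close> in the unit disc. Parseval's identity
  for \<open>p f\<close>, with \<open>p\<close> a polynomial, restricts the coefficients: if \<open>\<theta> ^ 4 \<le> \<theta> ^ 3 + 1\<close>, they begin with
  1, 1, 1, 1 or 1, 1, 1, 2, which forces \<open>\<theta> ^ 3 = \<theta> + 1\<close> or \<open>\<theta> ^ 4 = \<theta> ^ 3 + 1\<close>.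
\<close>

section \<open>Spectra and gaps\<close>

text \<open>A 0-1 digit sequence is encoded by its support, so that joining sums with disjoint
  exponents becomes a union of sets and multiplying by \<open>q ^ m\<close> becomes a shift.\<close>

definition digit_sum :: "real \<Rightarrow> nat set \<Rightarrow> real" where
  "digit_sum q S = (\<Sum>i\<in>S. q ^ i)"

lemma digit_sum_empty [simp]: "digit_sum q {} = 0"
  by (simp add: digit_sum_def)

lemma digit_sum_Un:
  assumes "finite S" "finite T" "S \<inter> T = {}"
  shows "digit_sum q (S \<union> T) = digit_sum q S + digit_sum q T"
  unfolding digit_sum_def using assms by (rule sum.union_disjoint)

lemma digit_sum_shift: "digit_sum q ((\<lambda>i. i + m) ` S) = q ^ m * digit_sum q S"
  unfolding digit_sum_def by (subst sum.reindex) (auto simp: sum_distrib_left power_add mult.commute)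

lemma digit_sum_mult: "k > 0 \<Longrightarrow> digit_sum q ((\<lambda>i. k * i) ` S) = digit_sum (q ^ k) S"
  unfolding digit_sum_def by (subst sum.reindex) (auto simp: power_mult inj_on_def)

lemma X1_eq_digit_sum: "X1 q = {digit_sum q S | S. finite S}"
proof (intro equalityI subsetI)
  fix x assume "x \<in> X1 q"
  then obtain n s where x: "x = (\<Sum>i\<le>n. s i * q ^ i)" "\<forall>i\<le>n. s i \<in> {0, 1 :: real}"
    unfolding X1_def by auto
  have "x = (\<Sum>i\<in>{i\<in>{..n}. s i = 1}. q ^ i)"
    unfolding x(1) using x(2) by (intro sum.mono_neutral_cong_right) auto
  then show "x \<in> {digit_sum q S | S. finite S}"
    by (auto simp: digit_sum_def intro!: exI[of _ "{i\<in>{..n}. s i = 1}"])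
next
  fix x assume "x \<in> {digit_sum q S | S. finite S}"
  then obtain S where S: "finite S" "x = digit_sum q S" by auto
  from S(1) obtain n where n: "S \<subseteq> {..n}"
    using finite_nat_iff_bounded_le by blast
  have "x = (\<Sum>i\<le>n. (if i \<in> S then 1 else 0) * q ^ i)"
    unfolding S(2) digit_sum_def using n by (intro sum.mono_neutral_cong_left) auto
  then show "x \<in> X1 q"
    unfolding X1_def by (intro CollectI exI[of _ n] exI[of _ "\<lambda>i. if i \<in> S then 1 else 0"]) auto
qed

text \<open>Greedy expansion: \<open>q ^ n\<close> is subtracted only if the lower powers cannot
  reach \<open>y\<close>. Since \<open>q \<le> 2\<close> gives
  \<open>q ^ n \<le> 1 + (\<Sum>i<n. q ^ i)\<close>, the remainder is then nonnegative, and it is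
  within reach of the lower powers.\<close>

lemma digit_sum_greedy_bounded:
  assumes "1 < q" "q \<le> 2" "0 \<le> y" "y < 1 + (\<Sum>i<n. q ^ i)"
  shows "\<exists>S\<subseteq>{..<n}. digit_sum q S \<le> y \<and> y < digit_sum q S + 1"
  using assms(3,4)
proof (induction n arbitrary: y)
  case 0
  then show ?case by simp
next
  case (Suc n)
  show ?case
  proof (cases "y < 1 + (\<Sum>i<n. q ^ i)")
    case True
    from Suc.IH[OF Suc.prems(1) True] obtain S where
      "S \<subseteq> {..<n}" "digit_sum q S \<le> y" "y < digit_sum q S + 1" by auto
    then show ?thesis by (intro exI[of _ S]) auto
  next
    case False
    have "q ^ n \<le> 1 + (\<Sum>i<n. q ^ i)" for n
    proof (induction n)
      case (Suc n)
      have "q ^ Suc n \<le> 2 * q ^ n" using assms by simp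
      with Suc show ?case by simp
    qed simp
    from this[of n] have "0 \<le> y - q ^ n" using False by simp
    moreover have "y - q ^ n < 1 + (\<Sum>i<n. q ^ i)" using Suc.prems by simp
    ultimately obtain S where S:
      "S \<subseteq> {..<n}" "digit_sum q S \<le> y - q ^ n" "y - q ^ n < digit_sum q S + 1"
      using Suc.IH by blast
    have "finite S" using S(1) finite_subset by blast
    then have "digit_sum q (insert n S) = q ^ n + digit_sum q S"
      unfolding digit_sum_def using S(1) by (subst sum.insert) auto
    then show ?thesis using S by (intro exI[of _ "insert n S"]) auto
  qed
qed

lemma digit_sum_greedy:
  assumes "1 < q" "q \<le> 2" "0 \<le> y"
  obtains S where "finite S" "digit_sum q S \<le> y" "y < digit_sum q S + 1"
proof -
  obtain n where n: "y < q ^ n" using real_arch_pow[OF assms(1)] by blast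
  also have "q ^ n \<le> (\<Sum>i<Suc n. q ^ i)" using assms by (simp add: sum_nonneg)
  finally have "y < 1 + (\<Sum>i<Suc n. q ^ i)" by linarith
  from digit_sum_greedy_bounded[OF assms this] obtain S where
    "S \<subseteq> {..<Suc n}" "digit_sum q S \<le> y" "y < digit_sum q S + 1" by auto
  then show ?thesis using that finite_subset by blast
qed

text \<open>
  Arbitrarily many of the sums \<open>a + q b\<close> lie in one interval of length 1, so two of them are close.
\<close>

lemma ex_close_digit_sums:
  assumes q: "1 < q" "q ^ 4 \<le> 2" and \<delta>: "0 < \<delta>"
    and indep: "\<And>S T S' T'. finite S \<Longrightarrow> finite T \<Longrightarrow> finite S' \<Longrightarrow> finite T' \<Longrightarrow>
      digit_sum (q ^ 4) S + q * digit_sum (q ^ 4) T = digit_sum (q ^ 4) S' + q * digit_sum (q ^ 4) T' \<Longrightarrow>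
      digit_sum (q ^ 4) T = digit_sum (q ^ 4) T'"
  shows "\<exists>U V. finite U \<and> finite V \<and> (\<forall>i\<in>U \<union> V. i mod 4 \<le> 1) \<and>
    0 < digit_sum q U - digit_sum q V \<and> digit_sum q U - digit_sum q V < \<delta>"
proof -
  have q4: "1 < q ^ 4" using q by simp
  \<comment> \<open>\<open>N\<close> boxes of length \<open>1 / N < \<delta>\<close> will receive
    \<open>N + 1\<close> sums.\<close>
  obtain N :: nat where N: "1 / \<delta> < real N" "N > 0"
    using reals_Archimedean2[of "max 0 (1 / \<delta>)"] by auto
  obtain B where B: "B \<subseteq> X1 (q ^ 4)" "finite B" "card B = Suc N"
    using infinite_arbitrarily_large[OF infinite_X1[OF q4]] by blast
  have "B \<noteq> {}" using B by auto
  \<comment> \<open>This choice makes \<open>T - q * b\<close> nonnegative for every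
    \<open>b \<in> B\<close>, so the greedy expansion applies to all of them.\<close>
  define T where "T = q * Max B"
  have "\<exists>S. finite S \<and> digit_sum (q ^ 4) S \<le> T - q * b \<and> T - q * b < digit_sum (q ^ 4) S + 1"
    if "b \<in> B" for b
  proof -
    have "b \<le> Max B" using that B by simp
    then have "0 \<le> T - q * b" unfolding T_def using q by simp
    from digit_sum_greedy[OF q4 q(2) this] show ?thesis by blast
  qed
  then obtain A where A: "\<And>b. b \<in> B \<Longrightarrow> finite (A b)"
      "\<And>b. b \<in> B \<Longrightarrow> digit_sum (q ^ 4) (A b) \<le> T - q * b"
      "\<And>b. b \<in> B \<Longrightarrow> T - q * b < digit_sum (q ^ 4) (A b) + 1"
    by metis
  have "\<forall>b\<in>B. \<exists>S. finite S \<and> b = digit_sum (q ^ 4) S"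
    using B(1) X1_eq_digit_sum by blast
  then obtain C where C: "\<And>b. b \<in> B \<Longrightarrow> finite (C b)" "\<And>b. b \<in> B \<Longrightarrow> b = digit_sum (q ^ 4) (C b)"
    by metis
  \<comment> \<open>Each \<open>v b\<close> lies in \<open>(T - 1, T]\<close>, and
    \<open>h b\<close> is the box of length \<open>1 / N\<close> that contains
    \<open>T - v b\<close>.\<close>
  define v where "v b = digit_sum (q ^ 4) (A b) + q * b" for b
  define h where "h b = nat \<lfloor>real N * (T - v b)\<rfloor>" for b
  have v: "0 \<le> T - v b" "T - v b < 1" if "b \<in> B" for b
    using A(2,3)[OF that] by (auto simp: v_def)
  have "h ` B \<subseteq> {..<N}"
  proof
    fix m assume "m \<in> h ` B"
    then obtain b where b: "b \<in> B" "m = h b" by auto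
    have "real N * (T - v b) < real N" using v[OF b(1)] N by simp
    then show "m \<in> {..<N}" using v[OF b(1)] b(2) N by (simp add: h_def floor_less_iff nat_less_iff)
  qed
  then have "card (h ` B) < card B" using B card_mono[of "{..<N}" "h ` B"] by simp
  then have "\<not> inj_on h B" by (rule pigeonhole)
  then obtain b b' where b: "b \<in> B" "b' \<in> B" "b \<noteq> b'" "h b = h b'"
    unfolding inj_on_def by blast
  have "v b \<noteq> v b'"
  proof
    assume "v b = v b'"
    then have "digit_sum (q ^ 4) (A b) + q * digit_sum (q ^ 4) (C b)
        = digit_sum (q ^ 4) (A b') + q * digit_sum (q ^ 4) (C b')"
      using C b by (simp add: v_def)
    then have "b = b'"
      using indep[of "A b" "C b" "A b'" "C b'"] A(1) C b by metis
    with b show False by simp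
  qed
  have "\<bar>real N * (T - v b) - real N * (T - v b')\<bar> < 1"
  proof -
    have "\<lfloor>real N * (T - v b)\<rfloor> = \<lfloor>real N * (T - v b')\<rfloor>"
      using b(4) v[OF b(1)] v[OF b(2)] by (simp add: h_def eq_nat_nat_iff)
    then show ?thesis by linarith
  qed
  moreover have "real N * (T - v b) - real N * (T - v b') = (v b' - v b) * real N"
    by (simp add: algebra_simps)
  ultimately have "\<bar>v b' - v b\<bar> * real N < 1" by (simp add: abs_mult)
  then have "\<bar>v b' - v b\<bar> < 1 / real N" using N by (simp add: field_simps)
  also have "1 / real N < \<delta>" using N \<delta> by (simp add: field_simps)
  finally have close: "\<bar>v b' - v b\<bar> < \<delta>" .
  \<comment> \<open>Exponents \<open>4 * i\<close> carry the summand from the spectrum of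
    \<open>q ^ 4\<close>, exponents \<open>4 * i + 1\<close> carry its multiple by
    \<open>q\<close>.\<close>
  define E where "E b = (\<lambda>i. 4 * i) ` A b \<union> (\<lambda>i. i + 1) ` (\<lambda>i. 4 * i) ` C b" for b
  have E: "finite (E b)" "\<forall>i\<in>E b. i mod 4 \<le> 1" "digit_sum q (E b) = v b" if "b \<in> B" for b
  proof -
    show "finite (E b)" using A(1) C(1) that by (simp add: E_def)
    have "(4 * i + 1) mod 4 = 1" for i :: nat by presburger
    then show "\<forall>i\<in>E b. i mod 4 \<le> 1" by (auto simp: E_def)
    have "4 * i \<noteq> Suc (4 * j)" for i j :: nat by presburger
    then have "digit_sum q (E b) = digit_sum q ((\<lambda>i. 4 * i) ` A b)
        + digit_sum q ((\<lambda>i. i + 1) ` (\<lambda>i. 4 * i) ` C b)"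
      unfolding E_def using A(1) C(1) that by (intro digit_sum_Un) auto
    also have "\<dots> = v b"
      unfolding digit_sum_shift using C(2)[OF that] by (simp add: digit_sum_mult v_def)
    finally show "digit_sum q (E b) = v b" .
  qed
  show ?thesis
  proof (cases "v b < v b'")
    case True
    then show ?thesis using E[OF b(1)] E[OF b(2)] close by (intro exI[of _ "E b'"] exI[of _ "E b"]) auto
  next
    case False
    then show ?thesis using E[OF b(1)] E[OF b(2)] close \<open>v b \<noteq> v b'\<close>
      by (intro exI[of _ "E b"] exI[of _ "E b'"]) auto
  qed
qed

text \<open>
  Multiplying a tiny difference by a power of \<open>q ^ 4\<close> gives one in \<open>[\<epsilon> / q ^ 4, \<epsilon>)\<close> whose exponents exceed
  all those used before and keep their residues modulo 4.
\<close>

lemma ex_dense_digit_sums: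
  assumes q: "1 < q" and \<epsilon>: "0 < \<epsilon>"
    and close: "\<And>\<delta>. 0 < \<delta> \<Longrightarrow> \<exists>U V. finite U \<and> finite V \<and> (\<forall>i\<in>U \<union> V. i mod 4 \<le> 1) \<and>
      0 < digit_sum q U - digit_sum q V \<and> digit_sum q U - digit_sum q V < \<delta>"
  shows "\<exists>N t. \<forall>y. t \<le> y \<and> y < t + \<epsilon> + real k * (\<epsilon> / q ^ 4) \<longrightarrow>
    (\<exists>S\<subseteq>{i. i < N \<and> i mod 4 \<le> 1}. digit_sum q S \<le> y \<and> y < digit_sum q S + \<epsilon>)"
proof (induction k)
  case 0
  \<comment> \<open>The empty sum alone covers \<open>[0, \<epsilon>)\<close>.\<close>
  show ?case by (intro exI[of _ 0]) auto
next
  case (Suc k)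
  then obtain N t where IH: "\<And>y. t \<le> y \<Longrightarrow> y < t + \<epsilon> + real k * (\<epsilon> / q ^ 4) \<Longrightarrow>
    (\<exists>S\<subseteq>{i. i < N \<and> i mod 4 \<le> 1}. digit_sum q S \<le> y \<and> y < digit_sum q S + \<epsilon>)"
    by blast
  have q4: "1 < q ^ 4" using q by simp
  \<comment> \<open>With \<open>d\<close> this small, scaling it up to \<open>\<epsilon>\<close>
    takes more than \<open>N\<close> factors \<open>q ^ 4\<close>. The shift therefore moves past
    all exponents below \<open>N\<close>.\<close>
  define \<delta> where "\<delta> = \<epsilon> / (q ^ 4) ^ N"
  have "0 < \<delta>" using \<epsilon> q by (simp add: \<delta>_def)
  from close[OF this] obtain U V where UV: "finite U" "finite V" "\<forall>i\<in>U \<union> V. i mod 4 \<le> 1"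
      "0 < digit_sum q U - digit_sum q V" "digit_sum q U - digit_sum q V < \<delta>" by blast
  define d where "d = digit_sum q U - digit_sum q V"
  have "\<exists>m. \<epsilon> \<le> d * (q ^ 4) ^ m"
    using real_arch_pow[OF q4, of "\<epsilon> / d"] UV(4) by (auto simp: d_def field_simps intro: less_imp_le)
  \<comment> \<open>The exponent just below the least \<open>m\<close> is used: it places
    \<open>D\<close> in \<open>[\<epsilon> / q ^ 4, \<epsilon>)\<close>.\<close>
  define m where "m = (LEAST m. \<epsilon> \<le> d * (q ^ 4) ^ m)"
  have m: "\<epsilon> \<le> d * (q ^ 4) ^ m"
    unfolding m_def by (rule LeastI_ex) fact
  have "N < m"
  proof (rule ccontr)
    assume "\<not> N < m"
    then have "(q ^ 4) ^ m \<le> (q ^ 4) ^ N" using q4 by (simp add: power_increasing)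
    then have "d * (q ^ 4) ^ m \<le> d * (q ^ 4) ^ N" using UV(4) by (simp add: d_def)
    also have "\<dots> < \<delta> * (q ^ 4) ^ N" using UV(5) q by (simp add: d_def)
    also have "\<dots> = \<epsilon>" using q by (simp add: \<delta>_def)
    finally show False using m by simp
  qed
  then obtain m' where m': "m = Suc m'" "N \<le> m'" by (cases m) auto
  define D where "D = d * (q ^ 4) ^ m'"
  have "D < \<epsilon>" using not_less_Least[of m' "\<lambda>m. \<epsilon> \<le> d * (q ^ 4) ^ m"] m' by (auto simp: m_def D_def)
  have "\<epsilon> / q ^ 4 \<le> D" using m q by (simp add: m' D_def field_simps)
  define U' V' where "U' = (\<lambda>i. i + 4 * m') ` U" and "V' = (\<lambda>i. i + 4 * m') ` V"
  have shifts: "digit_sum q U' = q ^ (4 * m') * digit_sum q U" "digit_sum q V' = q ^ (4 * m') * digit_sum q V"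
    unfolding U'_def V'_def by (rule digit_sum_shift)+
  have D: "digit_sum q U' = digit_sum q V' + D"
    unfolding shifts D_def d_def power_mult by (simp add: algebra_simps)
  have UV': "finite U'" "finite V'" "\<forall>i\<in>U' \<union> V'. i mod 4 \<le> 1 \<and> N \<le> i"
    using UV m' by (auto simp: U'_def V'_def)
  define N' where "N' = Suc (Max (insert N (U' \<union> V')))"
  have N': "N < N'" "\<forall>i\<in>U' \<union> V'. i < N'"
    using UV' by (auto simp: N'_def less_Suc_eq_le)
  \<comment> \<open>Adding the fresh block \<open>U'\<close> or \<open>V'\<close> translates the
    interval that is already covered.\<close>
  have step: "\<exists>S\<subseteq>{i. i < N' \<and> i mod 4 \<le> 1}. digit_sum q S \<le> y \<and> y < digit_sum q S + \<epsilon>"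
    if W: "W = U' \<or> W = V'" and y: "t \<le> y - digit_sum q W"
      "y - digit_sum q W < t + \<epsilon> + real k * (\<epsilon> / q ^ 4)" for y W
  proof -
    from IH[OF y] obtain S where S: "S \<subseteq> {i. i < N \<and> i mod 4 \<le> 1}"
      "digit_sum q S \<le> y - digit_sum q W" "y - digit_sum q W < digit_sum q S + \<epsilon>" by blast
    have "finite S" by (rule finite_subset[OF S(1)]) auto
    moreover have "finite W" using W UV' by blast
    moreover have "S \<inter> W = {}"
    proof -
      have "i < N" if "i \<in> S" for i using S(1) that by blast
      moreover have "N \<le> i" if "i \<in> W" for i using W UV'(3) that by blast
      ultimately show ?thesis by (meson disjoint_iff linorder_not_le)
    qed
    ultimately have "digit_sum q (S \<union> W) = digit_sum q S + digit_sum q W" by (simp add: digit_sum_Un)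
    moreover have "S \<union> W \<subseteq> {i. i < N' \<and> i mod 4 \<le> 1}" using W S(1) UV'(3) N' by auto
    ultimately show ?thesis using S by (intro exI[of _ "S \<union> W"]) auto
  qed
  \<comment> \<open>The new interval is the union of the translates by \<open>V'\<close> and by
    \<open>U'\<close>, which differ by \<open>D\<close>. As \<open>D < \<epsilon>\<close> they
    overlap, and as \<open>D \<ge> \<epsilon> / q ^ 4\<close> the second one gains the required
    length.\<close>
  show ?case
  proof (rule exI[of _ N'], rule exI[of _ "t + digit_sum q V'"], intro allI impI)
    fix y assume y: "t + digit_sum q V' \<le> y \<and> y < t + digit_sum q V' + \<epsilon> + real (Suc k) * (\<epsilon> / q ^ 4)"
    show "\<exists>S\<subseteq>{i. i < N' \<and> i mod 4 \<le> 1}. digit_sum q S \<le> y \<and> y < digit_sum q S + \<epsilon>"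
    proof (cases "y - digit_sum q V' < t + \<epsilon>")
      case True
      have "0 \<le> real k * (\<epsilon> / q ^ 4)" using \<epsilon> q by simp
      then have "y - digit_sum q V' < t + \<epsilon> + real k * (\<epsilon> / q ^ 4)" using True by linarith
      moreover have "t \<le> y - digit_sum q V'" using y by linarith
      ultimately show ?thesis using step by blast
    next
      case False
      have "real (Suc k) * (\<epsilon> / q ^ 4) = real k * (\<epsilon> / q ^ 4) + \<epsilon> / q ^ 4"
        by (simp add: distrib_right add_divide_distrib)
      then have "y - digit_sum q U' < t + \<epsilon> + real k * (\<epsilon> / q ^ 4)"
        using y D \<open>\<epsilon> / q ^ 4 \<le> D\<close> by linarith
      moreover have "t \<le> y - digit_sum q U'" using False D \<open>D < \<epsilon>\<close> by linarith
      ultimately show ?thesis using step by blast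
    qed
  qed
qed

section \<open>From dense sums to vanishing gaps\<close>

lemma L1_eq_0I:
  assumes q: "1 < q" and dense: "\<And>\<epsilon>. 0 < \<epsilon> \<Longrightarrow> \<exists>t. \<forall>y\<ge>t. \<exists>x\<in>X1 q. x \<le> y \<and> y < x + \<epsilon>"
  shows "L1 q = 0"
proof -
  note x = x1_enumerates[OF q]
  have "(\<lambda>k. x1 q (Suc k) - x1 q k) \<longlonglongrightarrow> 0"
  proof (rule LIMSEQ_I)
    fix r :: real assume r: "0 < r"
    obtain t where t: "\<And>y. t \<le> y \<Longrightarrow> \<exists>x\<in>X1 q. x \<le> y \<and> y < x + r / 2"
      using dense[of "r / 2"] r by auto
    obtain K where K: "t \<le> x1 q K"
    proof -
      obtain x where "x \<in> X1 q" "t < x"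
      proof -
        have "\<not> X1 q \<subseteq> {y \<in> X1 q. y \<le> t}"
          using infinite_X1[OF q] finite_X1_atMost[OF q, of t] finite_subset by blast
        then show ?thesis using that by fastforce
      qed
      moreover from this(1) obtain j where "x = x1 q j" using x(2) by blast
      ultimately show ?thesis using that[of j] by simp
    qed
    show "\<exists>no. \<forall>n\<ge>no. norm (x1 q (Suc n) - x1 q n - 0) < r"
    proof (intro exI[of _ K] allI impI)
      fix n assume n: "K \<le> n"
      have lt: "x1 q n < x1 q (Suc n)" using strict_monoD[OF x(1)] by simp
      \<comment> \<open>Density is tested at \<open>x1 q n + r / 2\<close>. If the next element were
        larger than this, the element found there would lie strictly between two consecutive
        ones.\<close>
      have "x1 q (Suc n) \<le> x1 q n + r / 2"
      proof (rule ccontr)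
        assume *: "\<not> x1 q (Suc n) \<le> x1 q n + r / 2"
        have "t \<le> x1 q n + r / 2"
          using K strict_mono_less_eq[OF x(1), of K n] n r by linarith
        from t[OF this] obtain z where z: "z \<in> X1 q" "z \<le> x1 q n + r / 2" "x1 q n < z" by auto
        then obtain j where "z = x1 q j" using x(2) by blast
        then have "n < j" "j < Suc n" using z * strict_mono_less[OF x(1)] by (metis less_le_trans not_le le_less_trans)+
        then show False by simp
      qed
      then show "norm (x1 q (Suc n) - x1 q n - 0) < r" using lt r by simp
    qed
  qed
  then have "(\<lambda>k. ereal (x1 q (Suc k) - x1 q k)) \<longlonglongrightarrow> ereal 0" by (intro tendsto_intros)
  then show ?thesis unfolding L1_def zero_ereal_def[symmetric] by (intro lim_imp_Limsup) auto
qed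

lemma L1_eq_0_of_independent:
  assumes q: "1 < q" "q ^ 4 \<le> 2"
    and indep: "\<And>S T S' T'. finite S \<Longrightarrow> finite T \<Longrightarrow> finite S' \<Longrightarrow> finite T' \<Longrightarrow>
      digit_sum (q ^ 4) S + q * digit_sum (q ^ 4) T = digit_sum (q ^ 4) S' + q * digit_sum (q ^ 4) T' \<Longrightarrow>
      digit_sum (q ^ 4) T = digit_sum (q ^ 4) T'"
  shows "L1 q = 0"
proof (rule L1_eq_0I[OF q(1)])
  fix \<epsilon> :: real assume \<epsilon>: "0 < \<epsilon>"
  have close: "\<exists>U V. finite U \<and> finite V \<and> (\<forall>i\<in>U \<union> V. i mod 4 \<le> 1) \<and>
      0 < digit_sum q U - digit_sum q V \<and> digit_sum q U - digit_sum q V < \<delta>" if "0 < \<delta>" for \<delta>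
    using q that indep by (rule ex_close_digit_sums)
  have e4: "0 < \<epsilon> / q ^ 4" using \<epsilon> q by simp
  \<comment> \<open>The finely covered interval must be longer than \<open>q ^ 2\<close>, the bound
    for the gaps of the sums with exponents congruent to 2 modulo 4.\<close>
  obtain k where k: "q ^ 2 / (\<epsilon> / q ^ 4) < real k" using reals_Archimedean2 by blast
  then have k: "q ^ 2 < real k * (\<epsilon> / q ^ 4)" unfolding divide_less_eq using e4 by simp
  obtain N t where dense: "\<And>y. t \<le> y \<Longrightarrow> y < t + \<epsilon> + real k * (\<epsilon> / q ^ 4) \<Longrightarrow>
    (\<exists>S\<subseteq>{i. i < N \<and> i mod 4 \<le> 1}. digit_sum q S \<le> y \<and> y < digit_sum q S + \<epsilon>)"
    using ex_dense_digit_sums[OF q(1) \<epsilon> close, of k] by blast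
  show "\<exists>t. \<forall>y\<ge>t. \<exists>x\<in>X1 q. x \<le> y \<and> y < x + \<epsilon>"
  proof (intro exI allI impI)
    fix y assume "t \<le> y"
    then have y: "0 \<le> (y - t) / q ^ 2" using q by simp
    \<comment> \<open>The coarse part: its sum, multiplied by \<open>q ^ 2\<close>, brings
      \<open>y\<close> down into the finely covered interval starting at \<open>t\<close>.\<close>
    obtain T where T: "finite T" "digit_sum (q ^ 4) T \<le> (y - t) / q ^ 2"
        "(y - t) / q ^ 2 < digit_sum (q ^ 4) T + 1"
      using digit_sum_greedy[OF _ q(2) y] q by auto
    define T' where "T' = (\<lambda>i. i + 2) ` (\<lambda>i. 4 * i) ` T"
    have T': "digit_sum q T' = q ^ 2 * digit_sum (q ^ 4) T"
      unfolding T'_def digit_sum_shift by (simp add: digit_sum_mult)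
    have "digit_sum q T' \<le> y - t" "y - t < digit_sum q T' + q ^ 2"
      using T q by (simp_all add: T' field_simps)
    then obtain S where S: "S \<subseteq> {i. i < N \<and> i mod 4 \<le> 1}"
        "digit_sum q S \<le> y - digit_sum q T'" "y - digit_sum q T' < digit_sum q S + \<epsilon>"
      using dense[of "y - digit_sum q T'"] k \<epsilon> by auto
    have "finite S" by (rule finite_subset[OF S(1)]) auto
    have "(4 * i + 2) mod 4 = 2" for i :: nat by presburger
    then have "S \<inter> T' = {}" using S(1) unfolding T'_def by force
    then have "digit_sum q (S \<union> T') = digit_sum q S + digit_sum q T'"
      using \<open>finite S\<close> T(1) by (intro digit_sum_Un) (auto simp: T'_def)
    moreover have "digit_sum q (S \<union> T') \<in> X1 q"
      unfolding X1_eq_digit_sum using \<open>finite S\<close> T(1) by (auto simp: T'_def)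
    ultimately show "\<exists>x\<in>X1 q. x \<le> y \<and> y < x + \<epsilon>" using S by (intro bexI) auto
  qed
qed

section \<open>Minimal polynomials of Pisot numbers\<close>

lemma map_poly_hom_add:
  assumes "f 0 = 0" "\<And>x y. f (x + y) = f x + f y"
  shows "map_poly f (p + q) = map_poly f p + map_poly f q"
  by (rule poly_eqI) (simp add: coeff_map_poly assms)

lemma map_poly_hom_mult:
  assumes f: "f 0 = 0" "\<And>x y. f (x + y) = f x + f y" "\<And>x y. f (x * y) = f x * f y"
  shows "map_poly f (p * q) = map_poly f p * map_poly f q"
proof (induction p)
  case (pCons a p)
  then show ?case
    by (simp add: map_poly_hom_add[OF f(1,2)] map_poly_smult f map_poly_pCons)
qed simp

lemma map_poly_hom_pcompose:
  assumes f: "f 0 = 0" "\<And>x y. f (x + y) = f x + f y" "\<And>x y. f (x * y) = f x * f y"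
  shows "map_poly f (pcompose p q) = pcompose (map_poly f p) (map_poly f q)"
  by (induction p)
     (simp_all add: map_poly_hom_add[OF f(1,2)] map_poly_hom_mult[OF f] map_poly_pCons f pcompose_pCons)

lemma map_poly_reflect_poly:
  assumes "f 0 = 0" "\<And>x. x \<noteq> 0 \<Longrightarrow> f x \<noteq> 0"
  shows "map_poly f (reflect_poly p) = reflect_poly (map_poly f p)"
  by (rule poly_eqI) (simp add: coeff_map_poly assms coeff_reflect_poly degree_map_poly)

lemma of_rat_of_int_poly:
  "map_poly of_rat (map_poly of_int P) = (map_poly of_int P :: 'a :: field_char_0 poly)"
  by (simp add: map_poly_map_poly o_def)

lemmas of_rat_poly_add = map_poly_hom_add[of of_rat, simplified of_rat_add of_rat_0, simplified]
lemmas of_rat_poly_mult = map_poly_hom_mult[of of_rat, simplified of_rat_add of_rat_mult of_rat_0, simplified]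
lemmas of_rat_poly_pcompose = map_poly_hom_pcompose[of of_rat, simplified of_rat_add of_rat_mult of_rat_0, simplified]

lemma of_rat_poly_pderiv:
  "map_poly of_rat (pderiv p) = pderiv (map_poly of_rat p :: 'a :: field_char_0 poly)"
  by (rule poly_eqI) (simp add: coeff_map_poly coeff_pderiv of_rat_mult del: of_nat_Suc)

lemma of_rat_poly_dvd_root:
  assumes "p dvd f" "poly (map_poly of_rat p) (w :: 'a :: field_char_0) = 0"
  shows "poly (map_poly of_rat f) w = 0"
  using assms by (auto simp: dvd_def of_rat_poly_mult)

section \<open>Minimal polynomials: divisibility, existence, integrality, separability\<close>

text \<open>If the irreducible \<open>p\<close> did not divide \<open>f\<close>, Bezout would
  express 1 as a combination of \<open>p\<close> and \<open>f\<close>, which both vanish at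
  \<open>z\<close>.\<close>

lemma minimal_polynomial_dvd:
  assumes "minimal_polynomial p z" "poly (map_poly of_rat f) z = 0"
  shows "p dvd f"
proof (rule ccontr)
  assume not_dvd: "\<not> p dvd f"
  have "prime_elem p"
    using assms(1) by (simp add: minimal_polynomial_def prime_elem_iff_irreducible)
  then have "gcd p f = 1" using not_dvd prime_elem_imp_coprime coprime_iff_gcd_eq_1 by blast
  moreover have "\<exists>u v. u * p + v * f = gcd p f"
    using bezout_coefficients_fst_snd by blast
  ultimately obtain u v where "u * p + v * f = 1" by auto
  then have "map_poly of_rat u * map_poly of_rat p + map_poly of_rat v * map_poly of_rat f = (1 :: complex poly)"
    by (metis of_rat_poly_add of_rat_poly_mult map_poly_1' of_rat_1)
  then have "poly (map_poly of_rat u * map_poly of_rat p + map_poly of_rat v * map_poly of_rat f) z = poly 1 z"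
    by simp
  then show False using assms by (simp add: minimal_polynomial_def)
qed

text \<open>A nonzero polynomial of least degree vanishing at \<open>z\<close> is irreducible: a
  factor vanishing at \<open>z\<close> already has full degree, so its cofactor is a unit. Scaling
  makes it monic.\<close>

lemma ex_minimal_polynomial:
  assumes "R \<noteq> 0" "poly (map_poly of_rat R) z = 0"
  shows "\<exists>p. minimal_polynomial p z"
proof -
  define root where "root p \<longleftrightarrow> p \<noteq> 0 \<and> poly (map_poly of_rat p) z = 0" for p
  obtain p where p: "root p" "\<And>f. root f \<Longrightarrow> degree p \<le> degree f"
    using ex_has_least_nat[of root R degree] assms by (auto simp: root_def)
  have "p \<noteq> 0" using p(1) by (simp add: root_def)
  have unit: "b dvd 1" if "p = a * b" "root a" for a b
  proof -
    have "a \<noteq> 0" "b \<noteq> 0" using that \<open>p \<noteq> 0\<close> by auto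
    then have "degree p = degree a + degree b" using that(1) by (simp add: degree_mult_eq)
    then have "degree b = 0" using p(2)[OF that(2)] by simp
    then show ?thesis using \<open>b \<noteq> 0\<close> by (simp add: is_unit_iff_degree)
  qed
  have "irreducible p"
  proof (rule irreducibleI)
    show "p \<noteq> 0" by fact
    show "\<not> p dvd 1"
    proof
      assume "p dvd 1"
      then have "poly (map_poly of_rat (1 :: rat poly)) z = 0"
        by (rule of_rat_poly_dvd_root) (use p(1) root_def in blast)
      then show False by simp
    qed
    fix a b assume ab: "p = a * b"
    then have "root a \<or> root b" using p(1) by (auto simp: root_def of_rat_poly_mult)
    then show "a dvd 1 \<or> b dvd 1" using unit[of a b] unit[of b a] ab by (auto simp: mult.commute)
  qed
  define m where "m = smult (inverse (lead_coeff p)) p"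
  have "lead_coeff p \<noteq> 0" using \<open>p \<noteq> 0\<close> by simp
  then have "m = [:inverse (lead_coeff p):] * p" "[:inverse (lead_coeff p):] dvd 1"
    by (simp_all add: m_def is_unit_const_poly_iff dvd_field_iff)
  then have "irreducible m" using \<open>irreducible p\<close> irreducible_mult_unit_left by metis
  moreover have "lead_coeff m = 1" using \<open>p \<noteq> 0\<close> by (simp add: m_def)
  moreover have "poly (map_poly of_rat m) z = 0"
    using p(1) by (simp add: m_def root_def map_poly_smult of_rat_mult)
  ultimately show ?thesis unfolding minimal_polynomial_def by blast
qed

lemma ex_int_multiple_poly:
  fixes p :: "rat poly"
  shows "\<exists>D P. D > 0 \<and> map_poly of_int P = smult (of_int D) p"
proof (induction p)
  case 0
  show ?case by (intro exI[of _ 1] exI[of _ 0]) simp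
next
  case (pCons c p)
  then obtain D P where D: "D > 0" "map_poly of_int P = smult (of_int D) p" by blast
  obtain a b where c: "c = of_int a / of_int b" "b > 0"
    by (metis Fract_of_int_quotient Rat_cases)
  have "map_poly of_int (pCons (a * D) (smult b P)) = smult (of_int (D * b)) (pCons c p)"
    using c by (simp add: map_poly_pCons map_poly_smult D(2) mult.commute)
  then show ?case using D(1) c(2) by (intro exI[of _ "D * b"]) auto
qed

text \<open>Gauss's lemma. Clear denominators in the monic factorization \<open>R = p * s\<close>,
  obtaining integer polynomials \<open>P\<close>, \<open>S\<close> with leading coefficients
  \<open>D\<close>, \<open>E\<close>. The contents divide \<open>D\<close> and \<open>E\<close> and
  have product \<open>D * E\<close>, so \<open>P\<close> has content \<open>D\<close> and its
  primitive part is \<open>p\<close>.\<close>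

lemma minimal_polynomial_int:
  assumes p: "minimal_polynomial p z" and z: "algebraic_int z"
  shows "\<exists>P. p = map_poly of_int P"
proof -
  obtain R where R: "poly (map_poly of_int R) z = 0" "lead_coeff R = 1"
    using z algebraic_int_altdef_ipoly by blast
  have "p dvd map_poly of_int R"
    using R by (intro minimal_polynomial_dvd[OF p]) (simp add: of_rat_of_int_poly)
  then obtain s where s: "map_poly of_int R = p * s" by (auto simp: dvd_def)
  have lead_R: "lead_coeff (map_poly rat_of_int R) = 1"
    using R(2) by (subst lead_coeff_map_poly_nz) auto
  have lead: "lead_coeff p = 1" "lead_coeff s = 1"
    using p lead_R by (simp_all add: minimal_polynomial_def s lead_coeff_mult)
  obtain D P where P: "D > 0" "map_poly of_int P = smult (of_int D) p"
    using ex_int_multiple_poly by blast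
  obtain E S where S: "E > 0" "map_poly of_int S = smult (of_int E) s"
    using ex_int_multiple_poly by blast
  have "map_poly rat_of_int (P * S) = smult (of_int D) p * smult (of_int E) s"
    by (simp add: map_poly_hom_mult P(2) S(2))
  also have "\<dots> = map_poly of_int (smult (D * E) R)"
    by (simp add: map_poly_smult s mult.commute)
  finally have "coeff (map_poly rat_of_int (P * S)) n = coeff (map_poly of_int (smult (D * E) R)) n" for n
    by simp
  then have PS: "P * S = smult (D * E) R"
    by (intro poly_eqI) (simp add: coeff_map_poly mult.assoc flip: of_int_mult)
  have "content R dvd 1" using R(2) content_dvd_coeff[of R "degree R"] by simp
  then have "content R = 1" by (rule is_unit_content_iff[THEN iffD1])
  then have content: "content P * content S = D * E"
    using content_mult[of P S] P(1) S(1) by (simp add: PS abs_mult)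
  have "lead_coeff (map_poly rat_of_int P) = of_int D" "lead_coeff (map_poly rat_of_int S) = of_int E"
    using lead by (simp_all add: P(2) S(2))
  then have "rat_of_int (lead_coeff P) = of_int D" "rat_of_int (lead_coeff S) = of_int E"
    by (simp_all add: coeff_map_poly degree_map_poly)
  then have "lead_coeff P = D" "lead_coeff S = E" by (simp_all only: of_int_eq_iff)
  then have "content P dvd D" "content S dvd E" by (metis content_dvd_coeff)+
  then have "content P \<le> D" "content S \<le> E" using P(1) S(1) by (simp_all add: zdvd_imp_le)
  moreover have "content P \<ge> 0" "content S \<ge> 0" by (metis abs_ge_zero normalize_content normalize_int_def)+
  moreover have "content S \<noteq> 0" using content P(1) S(1) by auto
  ultimately have "content S > 0" by linarith
  have "content P = D"
  proof (rule ccontr)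
    assume "content P \<noteq> D"
    then have "content P * content S < D * content S"
      using \<open>content P \<le> D\<close> \<open>content S > 0\<close> by (intro mult_strict_right_mono) auto
    also have "\<dots> \<le> D * E" using \<open>content S \<le> E\<close> P(1) by (intro mult_left_mono) auto
    finally show False using content by simp
  qed
  then have "smult (of_int D) (map_poly of_int (primitive_part P)) = smult (of_int D) p"
    using arg_cong[OF content_times_primitive_part[of P], of "map_poly rat_of_int"] P(2)
    by (simp add: map_poly_smult)
  then have "map_poly of_int (primitive_part P) = p"
    using P(1) smult_cancel[of "rat_of_int D"] by simp
  then show ?thesis by metis
qed

text \<open>A root shared with the derivative would make \<open>p\<close> divide a nonzero
  polynomial of smaller degree.\<close>

lemma minimal_polynomial_separable:
  assumes p: "minimal_polynomial p z" and w: "poly (map_poly of_rat p) w = 0"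
  shows "poly (pderiv (map_poly of_rat p)) w \<noteq> (0 :: complex)"
proof
  assume "poly (pderiv (map_poly of_rat p)) w = 0"
  moreover have "minimal_polynomial p w" using p w by (simp add: minimal_polynomial_def)
  ultimately have "p dvd pderiv p"
    by (intro minimal_polynomial_dvd) (simp_all add: of_rat_poly_pderiv)
  moreover have "degree p \<noteq> 0"
    using p by (auto simp: minimal_polynomial_def irreducible_def is_unit_iff_degree)
  ultimately show False
    using dvd_imp_degree_le[of p "pderiv p"] by (simp add: degree_pderiv pderiv_eq_0_iff)
qed

lemma Pisot_int_polynomial:
  assumes \<theta>: "Pisot \<theta>"
  obtains p P where "minimal_polynomial p (of_real \<theta>)" "p = map_poly of_int P"
    "\<And>w. poly (map_poly of_rat p) w = 0 \<Longrightarrow> w \<noteq> complex_of_real \<theta> \<Longrightarrow> norm w < 1"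
proof -
  have alg: "algebraic_int (complex_of_real \<theta>)" using \<theta> by (auto simp: Pisot_def)
  then obtain R where R: "poly (map_poly of_int R) (complex_of_real \<theta>) = 0" "lead_coeff R = 1"
    using algebraic_int_altdef_ipoly by blast
  have "\<exists>p. minimal_polynomial p (of_real \<theta>)"
    by (rule ex_minimal_polynomial[of "map_poly of_int R"])
       (use R in \<open>auto simp: of_rat_of_int_poly map_poly_eq_0_iff\<close>)
  then obtain p where p: "minimal_polynomial p (of_real \<theta>)" by blast
  obtain P where P: "p = map_poly of_int P" using minimal_polynomial_int[OF p alg] by blast
  have "norm w < 1" if "poly (map_poly of_rat p) w = 0" "w \<noteq> complex_of_real \<theta>" for w
    using \<theta> p that unfolding Pisot_def algebraic_conjugate_def by blast
  then show ?thesis using that p P by blast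
qed

text \<open>The minimal polynomial divides \<open>P\<close>, so every conjugate is a root of
  \<open>P\<close>. This spares an irreducibility proof for the concrete cubic and quartic.\<close>

lemma PisotI:
  assumes "lead_coeff P = 1" "\<theta> > 1" "poly (map_poly of_int P) (complex_of_real \<theta>) = 0"
    and "\<And>w. poly (map_poly of_int P) w = 0 \<Longrightarrow> w \<noteq> complex_of_real \<theta> \<Longrightarrow> norm w < 1"
  shows "Pisot \<theta>"
  unfolding Pisot_def
proof (intro conjI allI impI)
  have "algebraic_int (complex_of_real \<theta>)" using assms algebraic_int_altdef_ipoly by blast
  then show "algebraic_int \<theta>" by simp
  show "1 < \<theta>" by fact
  fix w assume w: "algebraic_conjugate (complex_of_real \<theta>) w \<and> w \<noteq> complex_of_real \<theta>"
  then obtain p where p: "minimal_polynomial p (of_real \<theta>)" "poly (map_poly of_rat p) w = 0"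
    by (auto simp: algebraic_conjugate_def)
  have "p dvd map_poly of_int P"
    by (rule minimal_polynomial_dvd[OF p(1)]) (simp add: of_rat_of_int_poly assms)
  from of_rat_poly_dvd_root[OF this p(2)] show "norm w < 1"
    using assms(4) w by (simp add: of_rat_of_int_poly)
qed

text \<open>
  All conjugates of \<open>sqrt \<beta>\<close> are square roots of conjugates of \<open>\<beta>\<close>, so only \<open>- sqrt \<beta>\<close> can prevent
  \<open>sqrt \<beta>\<close> from being a Pisot number.
\<close>

lemma Pisot_sqrt_conjugate:
  assumes \<beta>: "Pisot \<beta>" and nP: "\<not> Pisot (sqrt \<beta>)"
    and f: "poly (map_poly of_rat f) (complex_of_real (sqrt \<beta>)) = 0"
  shows "poly (map_poly of_rat f) (- complex_of_real (sqrt \<beta>)) = 0"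
proof (rule ccontr)
  let ?q = "complex_of_real (sqrt \<beta>)"
  assume nz: "poly (map_poly of_rat f) (- ?q) \<noteq> 0"
  have "\<beta> > 1" using \<beta> by (simp add: Pisot_def)
  then have q2: "?q ^ 2 = of_real \<beta>" by (simp flip: of_real_power)
  obtain m where m: "minimal_polynomial m (of_real \<beta>)"
      "\<And>w. poly (map_poly of_rat m) w = 0 \<Longrightarrow> w \<noteq> complex_of_real \<beta> \<Longrightarrow> norm w < 1"
    using Pisot_int_polynomial[OF \<beta>] by metis
  have "Pisot (sqrt \<beta>)"
    unfolding Pisot_def
  proof (intro conjI allI impI)
    show "algebraic_int (sqrt \<beta>)" using \<beta> by (auto simp: Pisot_def)
    show "sqrt \<beta> > 1" using \<open>\<beta> > 1\<close> by simp
    fix w assume w: "algebraic_conjugate ?q w \<and> w \<noteq> ?q"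
    then obtain p where p: "minimal_polynomial p ?q" "poly (map_poly of_rat p) w = 0"
      by (auto simp: algebraic_conjugate_def)
    have sq: "map_poly of_rat [:0, 0, 1:] = ([:0, 0, 1:] :: complex poly)" by (simp add: map_poly_pCons)
    have "p dvd pcompose m [:0, 0, 1:]"
      using m(1) q2 by (intro minimal_polynomial_dvd[OF p(1)])
        (simp add: of_rat_poly_pcompose sq poly_pcompose minimal_polynomial_def power2_eq_square)
    from of_rat_poly_dvd_root[OF this p(2)] have "poly (map_poly of_rat m) (w ^ 2) = 0"
      by (simp add: of_rat_poly_pcompose sq poly_pcompose power2_eq_square)
    moreover have "w ^ 2 \<noteq> of_real \<beta>"
    proof
      \<comment> \<open>Here \<open>w\<close> is \<open>- sqrt \<beta>\<close>, a root of
        \<open>p\<close>, and \<open>p\<close> divides \<open>f\<close>; so \<open>f\<close> would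
        vanish there, against \<open>nz\<close>.\<close>
      assume "w ^ 2 = of_real \<beta>"
      then have "w = - ?q" using w q2 by (metis power2_eq_iff)
      moreover have "poly (map_poly of_rat f) w = 0"
        using of_rat_poly_dvd_root[OF minimal_polynomial_dvd[OF p(1) f] p(2)] .
      ultimately show False using nz by simp
    qed
    ultimately have "norm (w ^ 2) < 1" using m(2) by blast
    then show "norm w < 1" by (simp add: norm_power abs_square_less_1)
  qed
  then show False using nP by simp
qed

text \<open>A relation \<open>A + q * B = 0\<close> with \<open>A\<close>, \<open>B\<close>
  polynomials in \<open>q ^ 4\<close> persists when \<open>q\<close> is replaced by
  \<open>- q\<close>. Subtracting the two relations gives \<open>B = 0\<close>, which is the
  required independence.\<close>

lemma L1_sqrt_Pisot:
  assumes \<beta>: "Pisot \<beta>" "\<beta>\<^sup>2 \<le> 2" and nP: "\<not> Pisot (sqrt \<beta>)"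
  shows "L1 (sqrt \<beta>) = 0"
proof (rule L1_eq_0_of_independent)
  let ?q = "sqrt \<beta>"
  have "\<beta> > 1" using \<beta> by (simp add: Pisot_def)
  then show "?q > 1" by simp
  have "?q ^ 4 = (?q ^ 2) ^ 2" by (simp flip: power_mult)
  then show "?q ^ 4 \<le> 2" using \<beta>(2) \<open>\<beta> > 1\<close> by simp
  fix S T S' T' :: "nat set"
  assume fin: "finite S" "finite T" "finite S'" "finite T'"
    and eq: "digit_sum (?q ^ 4) S + ?q * digit_sum (?q ^ 4) T = digit_sum (?q ^ 4) S' + ?q * digit_sum (?q ^ 4) T'"
  define C :: "nat set \<Rightarrow> nat set \<Rightarrow> rat poly" where
    "C A B = (\<Sum>i\<in>A. monom 1 (4 * i)) + (\<Sum>i\<in>B. monom (-1) (4 * i))" for A B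
  have sum: "map_poly of_rat (\<Sum>i\<in>A. monom c (4 * i)) = (\<Sum>i\<in>A. monom (of_rat c) (4 * i) :: complex poly)"
    if "finite A" for A c
    using that by (induction A) (simp_all add: of_rat_poly_add map_poly_monom)
  have C: "poly (map_poly of_rat (C A B)) (complex_of_real x) = of_real (digit_sum (x ^ 4) A - digit_sum (x ^ 4) B)"
    if "finite A" "finite B" for A B x
    using that by (simp add: C_def of_rat_poly_add sum poly_sum poly_monom digit_sum_def power_mult sum_negf)
  define W where "W = C S S' + [:0, 1:] * C T T'"
  have W: "poly (map_poly of_rat W) (complex_of_real x) =
      of_real (digit_sum (x ^ 4) S - digit_sum (x ^ 4) S' + x * (digit_sum (x ^ 4) T - digit_sum (x ^ 4) T'))" for x
    unfolding W_def of_rat_poly_add of_rat_poly_mult by (simp add: C fin map_poly_pCons)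
  have "poly (map_poly of_rat W) (complex_of_real ?q) = 0"
    unfolding W using eq by (simp only: of_real_eq_0_iff) (simp add: algebra_simps)
  then have "poly (map_poly of_rat W) (complex_of_real (- ?q)) = 0"
    using Pisot_sqrt_conjugate[OF \<beta>(1) nP] by simp
  then have "digit_sum (?q ^ 4) S - digit_sum (?q ^ 4) S' - ?q * (digit_sum (?q ^ 4) T - digit_sum (?q ^ 4) T') = 0"
    unfolding W by (simp only: of_real_eq_0_iff) simp
  then have "?q * (digit_sum (?q ^ 4) T - digit_sum (?q ^ 4) T') = 0"
    using eq unfolding right_diff_distrib by linarith
  then show "digit_sum (?q ^ 4) T = digit_sum (?q ^ 4) T'" using \<open>?q > 1\<close> by simp
qed


section \<open>The minimal polynomial of a Pisot number below 2\<close>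

text \<open>These properties make \<open>1 / \<theta>\<close> a simple pole of \<open>P / Q\<close>
  with nonzero residue, where \<open>Q\<close> is the reciprocal of \<open>P\<close>.\<close>

lemma Pisot_polynomial:
  assumes \<theta>: "Pisot \<theta>" "\<theta> < 2"
  obtains P :: "int poly" where "lead_coeff P = 1"
    "\<And>w. poly (map_poly of_int P) w = 0 \<Longrightarrow> w = complex_of_real \<theta> \<or> norm w < 1"
    "poly (map_poly of_int P) (complex_of_real \<theta>) = 0"
    "poly (pderiv (map_poly of_int P)) (complex_of_real \<theta>) \<noteq> 0"
    "poly (map_poly of_int P) (0 :: complex) \<noteq> 0"
    "poly (map_poly of_int P) (complex_of_real (inverse \<theta>)) \<noteq> 0"
proof -
  let ?t = "complex_of_real \<theta>"
  have "\<theta> > 1" using \<theta> by (simp add: Pisot_def)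
  obtain p P where p: "minimal_polynomial p ?t" and pP: "p = map_poly of_int P"
    and conj: "\<And>w. poly (map_poly of_rat p) w = 0 \<Longrightarrow> w \<noteq> ?t \<Longrightarrow> norm w < 1"
    using Pisot_int_polynomial[OF \<theta>(1)] by metis
  define f where "f = (map_poly of_int P :: complex poly)"
  have pf: "map_poly of_rat p = f" by (simp add: f_def pP of_rat_of_int_poly)
  have lead_p: "lead_coeff p = 1" and root: "poly f ?t = 0"
    using p by (simp_all add: minimal_polynomial_def pf)
  have degree: "degree f = degree p" by (simp add: degree_map_poly flip: pf)
  have lead_f: "lead_coeff f = 1" using lead_p degree by (simp add: coeff_map_poly flip: pf)
  have lead: "lead_coeff P = 1"
    using lead_p by (simp add: pP degree_map_poly coeff_map_poly)
  have roots_nz: "w \<noteq> 0" if "poly f w = 0" for w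
  proof
    \<comment> \<open>A root 0 would make \<open>p\<close> divide the monomial of degree 1, whose
      only root is 0, although \<open>p\<close> vanishes at \<open>\<theta>\<close>.\<close>
    assume "w = 0"
    then have "minimal_polynomial p 0" using that p by (simp add: minimal_polynomial_def pf)
    then have "p dvd [:0, 1:]" by (rule minimal_polynomial_dvd) (simp add: map_poly_pCons)
    moreover have "poly (map_poly of_rat [:0, 1:]) ?t \<noteq> 0"
      using \<open>\<theta> > 1\<close> by (simp add: map_poly_pCons)
    ultimately show False using of_rat_poly_dvd_root root pf by blast
  qed
  \<comment> \<open>Otherwise the roots are closed under inversion, so \<open>\<theta>\<close> and \<open>1 / \<theta>\<close> are all of them, and
    \<open>\<theta> + 1 / \<theta>\<close> is an integer strictly between 2 and 3.\<close>
  have "poly f (complex_of_real (inverse \<theta>)) \<noteq> 0"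
  proof
    assume inv_root: "poly f (complex_of_real (inverse \<theta>)) = 0"
    have reflect: "map_poly of_rat (reflect_poly p) = reflect_poly f"
      by (simp add: map_poly_reflect_poly flip: pf)
    have "p dvd reflect_poly p"
      using inv_root \<open>\<theta> > 1\<close>
      by (intro minimal_polynomial_dvd[OF p]) (simp add: reflect poly_reflect_poly_nz)
    then have "poly (reflect_poly f) w = 0" if "poly f w = 0" for w
      using that of_rat_poly_dvd_root[of p "reflect_poly p" w] by (simp add: reflect pf)
    then have inv: "poly f (inverse w) = 0" if "poly f w = 0" for w
      using that roots_nz[OF that] by (metis mult_eq_0_iff poly_reflect_poly_nz power_eq_0_iff)
    have "{w. poly f w = 0} = {?t, of_real (inverse \<theta>)}"
    proof (intro equalityI subsetI)
      fix w assume "w \<in> {w. poly f w = 0}"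
      then have w: "poly f w = 0" by simp
      show "w \<in> {?t, of_real (inverse \<theta>)}"
      proof (rule ccontr)
        assume not_in: "w \<notin> {?t, of_real (inverse \<theta>)}"
        then have "inverse w \<noteq> ?t" by (metis insertI1 insertI2 inverse_inverse_eq of_real_inverse)
        then have "norm (inverse w) < 1" "norm w < 1"
          using not_in conj inv[OF w] w by (auto simp: pf)
        then show False using roots_nz[OF w] by (simp add: norm_inverse inverse_less_1_iff)
      qed
    qed (use root inv_root in auto)
    moreover have "rsquarefree f"
      unfolding rsquarefree_roots using minimal_polynomial_separable[OF p] by (auto simp: pf)
    moreover have "?t \<noteq> of_real (inverse \<theta>)"
    proof
      assume "?t = of_real (inverse \<theta>)"
      then have "\<theta> = inverse \<theta>" by (simp only: of_real_eq_iff)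
      then have "\<theta> * \<theta> = 1" using \<open>\<theta> > 1\<close> by (simp add: field_simps)
      then show False using \<open>\<theta> > 1\<close> less_1_mult[of \<theta> \<theta>] by simp
    qed
    ultimately have "f = [:- ?t, 1:] * [:- of_real (inverse \<theta>), 1:]"
      using complex_poly_decompose_rsquarefree[of f] lead_f by simp
    then have "coeff f 1 = of_real (- (\<theta> + inverse \<theta>))" by simp
    moreover have "coeff f 1 = of_int (coeff P 1)" by (simp add: f_def coeff_map_poly)
    ultimately have "complex_of_real (of_int (coeff P 1)) = complex_of_real (- (\<theta> + inverse \<theta>))"
      by simp
    then have int: "of_int (coeff P 1) = - (\<theta> + inverse \<theta>)" by (simp only: of_real_eq_iff)
    have "2 < \<theta> + inverse \<theta>"
    proof -
      have "0 < (\<theta> - 1)\<^sup>2 * inverse \<theta>" using \<open>\<theta> > 1\<close> by simp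
      also have "\<dots> = \<theta> * (\<theta> * inverse \<theta>) - 2 * (\<theta> * inverse \<theta>) + inverse \<theta>"
        unfolding power2_eq_square by algebra
      finally show ?thesis using \<open>\<theta> > 1\<close> by simp
    qed
    moreover have "\<theta> + inverse \<theta> < 3"
      using \<open>\<theta> > 1\<close> \<theta>(2) inverse_less_1_iff[of \<theta>] by simp
    ultimately have "- 3 < coeff P 1" "coeff P 1 < - 2" using int by linarith+
    then show False by simp
  qed
  moreover have "poly (pderiv f) ?t \<noteq> 0"
    using minimal_polynomial_separable[OF p] root by (simp add: pf)
  moreover have "poly f 0 \<noteq> 0" using roots_nz by blast
  moreover have "w = ?t \<or> norm w < 1" if "poly f w = 0" for w using conj that by (auto simp: pf)
  ultimately show ?thesis using that lead root by (simp add: f_def)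
qed

section \<open>Parseval's inequality for functions unimodular on the circle\<close>

text \<open>The summands are the powers of \<open>x\<close>, an \<open>N\<close>-th root of unity.
  It equals 1 only if \<open>N\<close> divides \<open>k - l\<close>, that is, only for
  \<open>k = l\<close>; otherwise the geometric sum vanishes.\<close>

lemma sum_roots_of_unity_orthogonal:
  assumes "k < N" "l < N"
  shows "(\<Sum>j<N. cis (2 * pi * real j / real N) ^ k * cnj (cis (2 * pi * real j / real N) ^ l))
    = (if k = l then of_nat N else 0)"
proof -
  define x where "x = cis (2 * pi * (real k - real l) / real N)"
  have "N > 0" using assms by simp
  have "cis (2 * pi * real j / real N) ^ k * cnj (cis (2 * pi * real j / real N) ^ l) = x ^ j" for j
    unfolding x_def complex_cnj_power cis_cnj Complex.DeMoivre cis_mult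
    by (rule arg_cong[of _ _ cis]) (use \<open>N > 0\<close> in \<open>simp add: field_simps\<close>)
  then have eq: "(\<Sum>j<N. cis (2 * pi * real j / real N) ^ k * cnj (cis (2 * pi * real j / real N) ^ l))
    = (\<Sum>j<N. x ^ j)" by simp
  show ?thesis
  proof (cases "k = l")
    case True
    then show ?thesis unfolding eq by (simp add: x_def)
  next
    case False
    have "x ^ N = cis (2 * pi * (real k - real l))"
      using \<open>N > 0\<close> by (simp add: x_def Complex.DeMoivre)
    also have "\<dots> = 1" by (rule cis_multiple_2pi) simp
    finally have "x ^ N = 1" .
    moreover have "x \<noteq> 1"
    proof
      assume "x = 1"
      then have "cos (2 * pi * (real k - real l) / real N) = 1"
        unfolding x_def by (metis cis.sel(1) one_complex.sel(1))
      then obtain m :: int where "2 * pi * (real k - real l) / real N = of_int m * 2 * pi"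
        using cos_one_2pi_int by blast
      then have "(2 * pi) * (real k - real l) = (2 * pi) * (of_int m * real N)"
        using \<open>N > 0\<close> by (simp add: field_simps)
      then have "real k - real l = of_int m * real N"
        unfolding mult_cancel_left by simp
      then have "of_int (int k - int l) = (of_int (m * int N) :: real)" by simp
      then have m: "int k - int l = m * int N" by (simp only: of_int_eq_iff)
      then have "m \<noteq> 0" using False by auto
      then have "1 \<le> \<bar>m\<bar>" by linarith
      then have "int N \<le> \<bar>m * int N\<bar>" by (simp add: abs_mult mult_le_cancel_right1)
      then show False using m assms by linarith
    qed
    ultimately show ?thesis unfolding eq using False by (simp add: geometric_sum)
  qed
qed

text \<open>Averaging over the \<open>N\<close>-th roots of unity replaces the integral over the
  circle; it is exact because the degree is below \<open>N\<close>.\<close>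

lemma Parseval_roots_of_unity:
  assumes "degree p < N"
  shows "(\<Sum>j<N. (norm (poly p (cis (2 * pi * real j / real N))))\<^sup>2)
    = real N * (\<Sum>k<N. (norm (coeff p k))\<^sup>2)"
proof -
  let ?w = "\<lambda>j. cis (2 * pi * real j / real N)"
  have poly: "poly p z = (\<Sum>k<N. coeff p k * z ^ k)" for z
    unfolding poly_altdef using assms by (intro sum.mono_neutral_left) (auto simp: coeff_eq_0)
  have "complex_of_real (\<Sum>j<N. (norm (poly p (?w j)))\<^sup>2) = (\<Sum>j<N. poly p (?w j) * cnj (poly p (?w j)))"
    by (simp only: of_real_sum complex_norm_square)
  also have "\<dots> = (\<Sum>j<N. \<Sum>k<N. \<Sum>l<N. coeff p k * cnj (coeff p l) * (?w j ^ k * cnj (?w j ^ l)))"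
    by (simp only: poly cnj_sum sum_product complex_cnj_mult) (simp add: mult_ac)
  also have "\<dots> = (\<Sum>k<N. \<Sum>j<N. \<Sum>l<N. coeff p k * cnj (coeff p l) * (?w j ^ k * cnj (?w j ^ l)))"
    by (rule sum.swap)
  also have "\<dots> = (\<Sum>k<N. \<Sum>l<N. coeff p k * cnj (coeff p l) * (\<Sum>j<N. ?w j ^ k * cnj (?w j ^ l)))"
    unfolding sum_distrib_left by (rule sum.cong[OF refl], rule sum.swap)
  also have "\<dots> = (\<Sum>k<N. \<Sum>l<N. if k = l then coeff p k * cnj (coeff p k) * of_nat N else 0)"
    by (intro sum.cong refl) (simp add: sum_roots_of_unity_orthogonal del: complex_cnj_power)
  also have "\<dots> = of_real (real N * (\<Sum>k<N. (norm (coeff p k))\<^sup>2))"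
    by (simp add: sum_distrib_left mult_ac flip: complex_norm_square)
  finally show ?thesis by (simp only: of_real_eq_iff)
qed

text \<open>Both sides are averaged over the same roots of unity, more numerous than either
  degree.\<close>

lemma sum_norm_coeff_le:
  fixes u p :: "complex poly"
  assumes le: "\<And>z. norm z = 1 \<Longrightarrow> norm (poly u z) \<le> C * norm (poly p z)"
    and p: "degree p \<le> n" and C: "0 \<le> C"
  shows "(\<Sum>k\<le>m. (norm (coeff u k))\<^sup>2) \<le> C\<^sup>2 * (\<Sum>k\<le>n. (norm (coeff p k))\<^sup>2)"
proof -
  define N where "N = Suc (m + n + degree u)"
  let ?w = "\<lambda>j. cis (2 * pi * real j / real N)"
  have "real N * (\<Sum>k<N. (norm (coeff u k))\<^sup>2) = (\<Sum>j<N. (norm (poly u (?w j)))\<^sup>2)"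
    by (rule Parseval_roots_of_unity[symmetric]) (simp add: N_def)
  also have "\<dots> \<le> (\<Sum>j<N. (C * norm (poly p (?w j)))\<^sup>2)"
    by (intro sum_mono power_mono le) auto
  also have "\<dots> = C\<^sup>2 * (\<Sum>j<N. (norm (poly p (?w j)))\<^sup>2)"
    by (simp add: power_mult_distrib sum_distrib_left)
  also have "\<dots> = C\<^sup>2 * (real N * (\<Sum>k<N. (norm (coeff p k))\<^sup>2))"
    using p by (subst Parseval_roots_of_unity) (simp_all add: N_def)
  also have "(\<Sum>k<N. (norm (coeff p k))\<^sup>2) = (\<Sum>k\<le>n. (norm (coeff p k))\<^sup>2)"
    using p by (intro sum.mono_neutral_right) (auto simp: N_def coeff_eq_0)
  finally have "(\<Sum>k<N. (norm (coeff u k))\<^sup>2) \<le> C\<^sup>2 * (\<Sum>k\<le>n. (norm (coeff p k))\<^sup>2)"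
    by (simp add: N_def mult.left_commute)
  moreover have "(\<Sum>k\<le>m. (norm (coeff u k))\<^sup>2) \<le> (\<Sum>k<N. (norm (coeff u k))\<^sup>2)"
    by (intro sum_mono2) (auto simp: N_def)
  ultimately show ?thesis by linarith
qed

text \<open>
  On the unit circle \<open>f z = \<rho> / (1 - \<theta> z) + (\<Sum>k. e k * z ^ k)\<close> has the Laurent coefficients \<open>e k\<close> for
  \<open>k \<ge> 0\<close> and \<open>- \<rho> / \<theta> ^ m\<close> at \<open>- m < 0\<close>. Since \<open>f\<close> is unimodular there, multiplication by \<open>f\<close> does not
  change the square norm of a polynomial; the left-hand side omits the coefficients of \<open>p f\<close> beyond \<open>n\<close>.
  The proof truncates \<open>f\<close>, which avoids Fourier integrals.
\<close>

lemma unimodular_expansion_bound: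
  fixes \<theta> \<rho> :: real and e p :: "nat \<Rightarrow> real" and n :: nat
  assumes \<theta>: "1 < \<theta>" and e: "summable (\<lambda>k. \<bar>e k\<bar>)"
    and unimodular: "\<And>z. norm z = 1 \<Longrightarrow>
      norm (of_real \<rho> / (1 - of_real \<theta> * z) + (\<Sum>k. of_real (e k) * z ^ k :: complex)) = 1"
  defines "c \<equiv> \<rho> * (\<Sum>i\<le>n. p i / \<theta> ^ i)"
  shows "c\<^sup>2 / (\<theta>\<^sup>2 - 1) + (\<Sum>k\<le>n. ((\<Sum>i\<le>k. p i * (e (k - i) + \<rho> * \<theta> ^ (k - i))) - c * \<theta> ^ k)\<^sup>2)
    \<le> (\<Sum>i\<le>n. (p i)\<^sup>2)"
proof -
  define S where "S = (\<Sum>k\<le>n. ((\<Sum>i\<le>k. p i * (e (k - i) + \<rho> * \<theta> ^ (k - i))) - c * \<theta> ^ k)\<^sup>2)"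
  \<comment> \<open>Bounds the truncation error on the circle: the first term is for the pole part
    at exponents below \<open>- M\<close>, the second for the \<open>e k\<close> with
    \<open>k > M\<close>.\<close>
  define \<delta> where "\<delta> M = \<bar>\<rho>\<bar> * inverse \<theta> ^ M / (\<theta> - 1) + (\<Sum>k. \<bar>e (k + Suc M)\<bar>)" for M
  \<comment> \<open>Laurent coefficients of \<open>f\<close> moved up by \<open>M\<close>: index
    \<open>j\<close> stands for exponent \<open>j - M\<close>, and \<open>W M\<close> keeps the
    exponents from \<open>- M\<close> to \<open>M\<close>.\<close>
  define \<phi> where "\<phi> M j = (if j < M then - \<rho> / \<theta> ^ (M - j) else e (j - M))" for M j :: nat
  define P where "P = (\<Sum>i\<le>n. monom (complex_of_real (p i)) i)"
  define W where "W M = (\<Sum>j\<le>2 * M. monom (complex_of_real (\<phi> M j)) j)" for M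
  have coeff_P: "coeff P i = (if i \<le> n then of_real (p i) else 0)" for i
    by (simp add: P_def coeff_sum)
  have coeff_W: "coeff (W M) i = (if i \<le> 2 * M then of_real (\<phi> M i) else 0)" for M i
    by (simp add: W_def coeff_sum)
  have "degree P \<le> n" by (rule degree_le) (simp add: coeff_P)
  have tail0: "0 \<le> (\<Sum>k. \<bar>e (k + Suc M)\<bar>)" for M
    using summable_iff_shift[of "\<lambda>k. \<bar>e k\<bar>" "Suc M"] e by (intro suminf_nonneg) auto
  have \<delta>0: "0 \<le> \<delta> M" for M using tail0[of M] \<theta> by (simp add: \<delta>_def)
  have W_le: "norm (poly (W M) z) \<le> 1 + \<delta> M" if z: "norm z = 1" for M z
  proof -
    have "z \<noteq> 0" using z by auto
    have "\<theta> - 1 \<le> norm (1 - of_real \<theta> * z)"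
      using norm_triangle_ineq2[of "of_real \<theta> * z" 1] z \<theta> by (simp add: norm_mult norm_minus_commute)
    then have den: "1 - of_real \<theta> * z \<noteq> 0" using \<theta> by auto
    have sum_abs: "summable (\<lambda>k. norm (of_real (e k) * z ^ k))"
      using e z by (simp add: norm_mult norm_power)
    have sum: "summable (\<lambda>k. of_real (e k) * z ^ k)" by (rule summable_norm_cancel[OF sum_abs])
    have geometric: "(\<Sum>j<M. z ^ j / of_real \<theta> ^ (M - j)) * (1 - of_real \<theta> * z) = inverse (of_real \<theta>) ^ M - z ^ M"
    proof -
      have sum: "(\<Sum>j<M. z ^ j / of_real \<theta> ^ (M - j)) = inverse (of_real \<theta>) ^ M * (\<Sum>j<M. (of_real \<theta> * z) ^ j)"
        unfolding sum_distrib_left using \<theta>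
        by (intro sum.cong refl) (simp add: power_mult_distrib field_simps power_inverse flip: power_add)
      have "(\<Sum>j<M. z ^ j / of_real \<theta> ^ (M - j)) * (1 - of_real \<theta> * z)
          = inverse (of_real \<theta>) ^ M * (1 - (of_real \<theta> * z) ^ M)"
        unfolding sum using den by (simp add: sum_gp_strict)
      also have "\<dots> = inverse (of_real \<theta>) ^ M - z ^ M"
        using \<theta> by (simp add: right_diff_distrib power_mult_distrib[symmetric] mult.assoc[symmetric])
      finally show ?thesis .
    qed
    have "poly (W M) z = (\<Sum>j\<le>2 * M. of_real (\<phi> M j) * z ^ j)"
      by (simp add: W_def poly_sum poly_monom)
    also have "{..2 * M} = {..<M} \<union> {M..2 * M}" by auto
    also have "(\<Sum>j\<in>\<dots>. of_real (\<phi> M j) * z ^ j) =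
        (\<Sum>j<M. of_real (\<phi> M j) * z ^ j) + (\<Sum>j\<in>{M..2 * M}. of_real (\<phi> M j) * z ^ j)"
      by (rule sum.union_disjoint) auto
    also have "(\<Sum>j<M. of_real (\<phi> M j) * z ^ j) = - of_real \<rho> * (\<Sum>j<M. z ^ j / of_real \<theta> ^ (M - j))"
      unfolding sum_distrib_left by (intro sum.cong refl) (simp add: \<phi>_def)
    also have "(\<Sum>j<M. z ^ j / of_real \<theta> ^ (M - j)) = (inverse (of_real \<theta>) ^ M - z ^ M) / (1 - of_real \<theta> * z)"
      using geometric den by (simp add: eq_divide_eq)
    also have "(\<Sum>j\<in>{M..2 * M}. of_real (\<phi> M j) * z ^ j) = (\<Sum>k\<le>M. of_real (e k) * z ^ k) * z ^ M"
      unfolding sum_distrib_right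
      by (intro sum.reindex_bij_witness[of _ "\<lambda>k. k + M" "\<lambda>j. j - M"]) (auto simp: \<phi>_def simp flip: power_add)
    also have "(\<Sum>k\<le>M. of_real (e k) * z ^ k) = (\<Sum>k. of_real (e k) * z ^ k) - (\<Sum>k. of_real (e (k + Suc M)) * z ^ (k + Suc M))"
      using suminf_split_initial_segment[OF sum, of "Suc M"] by (simp add: lessThan_Suc_atMost)
    also have "- r * ((i - x) / d) + (a - b) * x = x * (r / d + a) - (r * i / d + x * b)"
      for r i x d a b :: complex
      by (simp add: algebra_simps diff_divide_distrib)
    \<comment> \<open>The truncation is \<open>z ^ M * f z\<close> minus the two tails, so its
      modulus is at most \<open>1 + \<delta> M\<close>.\<close>
    finally have "poly (W M) z = z ^ M * (of_real \<rho> / (1 - of_real \<theta> * z) + (\<Sum>k. of_real (e k) * z ^ k))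
        - (of_real \<rho> * inverse (of_real \<theta>) ^ M / (1 - of_real \<theta> * z)
          + z ^ M * (\<Sum>k. of_real (e (k + Suc M)) * z ^ (k + Suc M)))" .
    also have "norm \<dots> \<le> norm (z ^ M * (of_real \<rho> / (1 - of_real \<theta> * z) + (\<Sum>k. of_real (e k) * z ^ k)))
        + (norm (of_real \<rho> * inverse (of_real \<theta>) ^ M / (1 - of_real \<theta> * z))
          + norm (z ^ M * (\<Sum>k. of_real (e (k + Suc M)) * z ^ (k + Suc M))))"
      by (meson norm_triangle_ineq norm_triangle_ineq4 add_left_mono order_trans)
    also have "norm (z ^ M * (of_real \<rho> / (1 - of_real \<theta> * z) + (\<Sum>k. of_real (e k) * z ^ k))) = 1"
      using unimodular[OF z] z by (simp add: norm_mult norm_power)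
    also have "norm (of_real \<rho> * inverse (of_real \<theta>) ^ M / (1 - of_real \<theta> * z)) \<le> \<bar>\<rho>\<bar> * inverse \<theta> ^ M / (\<theta> - 1)"
      unfolding norm_divide norm_mult norm_power norm_inverse norm_of_real
      using \<theta> den \<open>\<theta> - 1 \<le> norm (1 - of_real \<theta> * z)\<close> by (intro frac_le) auto
    also have "norm (z ^ M * (\<Sum>k. of_real (e (k + Suc M)) * z ^ (k + Suc M))) \<le> (\<Sum>k. \<bar>e (k + Suc M)\<bar>)"
    proof -
      have "summable (\<lambda>k. norm (of_real (e (k + Suc M)) * z ^ (k + Suc M)))"
        by (rule summable_ignore_initial_segment[OF sum_abs])
      from summable_norm[OF this] show ?thesis using z by (simp add: norm_mult norm_power)
    qed
    finally show ?thesis by (simp add: \<delta>_def)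
  qed
  have bound: "c\<^sup>2 * (1 - (inverse \<theta> ^ 2) ^ (M - n)) / (\<theta>\<^sup>2 - 1) + S \<le> (1 + \<delta> M)\<^sup>2 * (\<Sum>i\<le>n. (p i)\<^sup>2)"
    if M: "n \<le> M" for M
  proof -
    \<comment> \<open>For indices from \<open>n\<close> to \<open>M + n\<close> the truncation is
      not felt: there \<open>U\<close> has the coefficients of \<open>p f\<close>, moved up by
      \<open>M\<close>.\<close>
    define U where "U = P * W M"
    have coeff_U: "coeff U m = of_real (\<Sum>i\<le>n. p i * \<phi> M (m - i))" if "n \<le> m" "m \<le> M + n" for m
    proof -
      have "coeff U m = (\<Sum>i\<le>m. coeff P i * coeff (W M) (m - i))" by (simp add: U_def coeff_mult)
      also have "\<dots> = (\<Sum>i\<le>n. of_real (p i * \<phi> M (m - i)))"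
        using that M by (intro sum.mono_neutral_cong_right) (auto simp: coeff_P coeff_W)
      finally show ?thesis by simp
    qed
    \<comment> \<open>At negative exponents only the pole contributes, and its contributions add up
      to a multiple of \<open>c\<close>.\<close>
    have neg: "(norm (coeff U m))\<^sup>2 = c\<^sup>2 * (inverse \<theta> ^ 2) ^ (M - m)" if "n \<le> m" "m < M" for m
    proof -
      have "(\<Sum>i\<le>n. p i * \<phi> M (m - i)) = (\<Sum>i\<le>n. - (\<rho> * (p i / \<theta> ^ i)) * inverse \<theta> ^ (M - m))"
      proof (intro sum.cong refl)
        fix i assume i: "i \<in> {..n}"
        then have eq: "M - (m - i) = (M - m) + i" and lt: "m - i < M" using that by auto
        have "\<phi> M (m - i) = - \<rho> / (\<theta> ^ (M - m) * \<theta> ^ i)"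
          unfolding \<phi>_def if_P[OF lt] eq power_add ..
        then show "p i * \<phi> M (m - i) = - (\<rho> * (p i / \<theta> ^ i)) * inverse \<theta> ^ (M - m)"
          using \<theta> by (simp add: field_simps)
      qed
      also have "\<dots> = - c * inverse \<theta> ^ (M - m)"
        by (simp add: c_def sum_distrib_left sum_distrib_right sum_negf)
      finally have "norm (coeff U m) = \<bar>c * inverse \<theta> ^ (M - m)\<bar>"
        using coeff_U[of m] that by (simp only: norm_of_real)
      then show ?thesis by (simp add: power_mult_distrib mult.commute flip: power_mult)
    qed
    \<comment> \<open>The terms with \<open>i > k\<close> still come from the pole. They are
      \<open>- c * \<theta> ^ k\<close> up to the terms with \<open>i \<le> k\<close>, which turn
      each \<open>e (k - i)\<close> into
      \<open>e (k - i) + \<rho> * \<theta> ^ (k - i)\<close>.\<close>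
    have pos: "coeff U (M + k) = of_real ((\<Sum>i\<le>k. p i * (e (k - i) + \<rho> * \<theta> ^ (k - i))) - c * \<theta> ^ k)" if "k \<le> n" for k
    proof -
      have "{..n} = {..k} \<union> {k<..n}" "{..k} \<inter> {k<..n} = {}" using that by auto
      then have split: "sum g {..n} = sum g {..k} + sum g {k<..n}" for g :: "nat \<Rightarrow> real"
        using sum.union_disjoint[of "{..k}" "{k<..n}" g] by simp
      have "c * \<theta> ^ k = (\<Sum>i\<le>n. \<rho> * p i * \<theta> ^ k / \<theta> ^ i)"
        by (simp add: c_def sum_distrib_left sum_distrib_right mult_ac)
      also note split
      also have "(\<Sum>i\<le>k. \<rho> * p i * \<theta> ^ k / \<theta> ^ i) = (\<Sum>i\<le>k. p i * (\<rho> * \<theta> ^ (k - i)))"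
        using \<theta> by (intro sum.cong refl) (simp add: power_diff)
      finally have c: "c * \<theta> ^ k = (\<Sum>i\<le>k. p i * (\<rho> * \<theta> ^ (k - i))) + (\<Sum>i\<in>{k<..n}. \<rho> * p i * \<theta> ^ k / \<theta> ^ i)" .
      have "(\<Sum>i\<le>n. p i * \<phi> M (M + k - i)) = (\<Sum>i\<le>k. p i * \<phi> M (M + k - i)) + (\<Sum>i\<in>{k<..n}. p i * \<phi> M (M + k - i))"
        by (rule split)
      also have "(\<Sum>i\<le>k. p i * \<phi> M (M + k - i)) = (\<Sum>i\<le>k. p i * e (k - i))"
        using M that by (intro sum.cong refl) (auto simp: \<phi>_def)
      also have "(\<Sum>i\<in>{k<..n}. p i * \<phi> M (M + k - i)) = - (\<Sum>i\<in>{k<..n}. \<rho> * p i * \<theta> ^ k / \<theta> ^ i)"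
        unfolding sum_negf[symmetric]
      proof (intro sum.cong refl)
        fix i assume i: "i \<in> {k<..n}"
        then have "M - (M + k - i) = i - k" "M + k - i < M" using M by auto
        then show "p i * \<phi> M (M + k - i) = - (\<rho> * p i * \<theta> ^ k / \<theta> ^ i)"
          using i \<theta> by (simp add: \<phi>_def power_diff)
      qed
      finally show ?thesis using M that by (simp add: coeff_U c distrib_left sum.distrib)
    qed
    have "(\<Sum>m\<in>{n..<M}. (norm (coeff U m))\<^sup>2) = (\<Sum>m\<in>{n..<M}. c\<^sup>2 * (inverse \<theta> ^ 2) ^ (M - m))"
      by (intro sum.cong refl neg) auto
    also have "\<dots> = c\<^sup>2 * (\<Sum>j<M - n. (inverse \<theta> ^ 2) ^ Suc j)"
      unfolding sum_distrib_left using M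
      by (intro sum.reindex_bij_witness[of _ "\<lambda>j. M - Suc j" "\<lambda>m. M - Suc m"]) (auto simp: Suc_diff_Suc)
    also have "(\<Sum>j<M - n. (inverse \<theta> ^ 2) ^ Suc j) = (1 - (inverse \<theta> ^ 2) ^ (M - n)) / (\<theta>\<^sup>2 - 1)"
    proof -
      have "inverse \<theta> ^ 2 \<noteq> 1" using \<theta> by (simp add: power_inverse power2_eq_1_iff)
      then have sum: "(\<Sum>j<M - n. (inverse \<theta> ^ 2) ^ j) = (1 - (inverse \<theta> ^ 2) ^ (M - n)) / (1 - inverse \<theta> ^ 2)"
        by (simp add: sum_gp_strict)
      have frac: "inverse \<theta> ^ 2 / (1 - inverse \<theta> ^ 2) = 1 / (\<theta>\<^sup>2 - 1)"
        using \<theta> \<open>inverse \<theta> ^ 2 \<noteq> 1\<close> by (simp add: divide_simps power2_eq_1_iff)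
      have "(\<Sum>j<M - n. (inverse \<theta> ^ 2) ^ Suc j) = inverse \<theta> ^ 2 * ((1 - (inverse \<theta> ^ 2) ^ (M - n)) / (1 - inverse \<theta> ^ 2))"
        by (simp only: power_Suc sum_distrib_left[symmetric] sum)
      also have "\<dots> = (1 - (inverse \<theta> ^ 2) ^ (M - n)) * (inverse \<theta> ^ 2 / (1 - inverse \<theta> ^ 2))"
        by (simp only: times_divide_eq_right mult.commute)
      finally show ?thesis unfolding frac by simp
    qed
    finally have A: "(\<Sum>m\<in>{n..<M}. (norm (coeff U m))\<^sup>2) = c\<^sup>2 * (1 - (inverse \<theta> ^ 2) ^ (M - n)) / (\<theta>\<^sup>2 - 1)"
      by simp
    have "(\<Sum>m\<in>{M..M + n}. (norm (coeff U m))\<^sup>2) = (\<Sum>k\<le>n. (norm (coeff U (M + k)))\<^sup>2)"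
      by (rule sum.reindex_bij_witness[of _ "\<lambda>k. M + k" "\<lambda>m. m - M"]) auto
    also have "\<dots> = S"
      unfolding S_def by (intro sum.cong refl) (simp only: pos norm_of_real power2_abs atMost_iff)
    finally have B: "(\<Sum>m\<in>{M..M + n}. (norm (coeff U m))\<^sup>2) = S" .
    have "{n..<M} \<union> {M..M + n} \<subseteq> {..M + n}" by auto
    then have "(\<Sum>m\<in>{n..<M} \<union> {M..M + n}. (norm (coeff U m))\<^sup>2) \<le> (\<Sum>m\<le>M + n. (norm (coeff U m))\<^sup>2)"
      by (intro sum_mono2) auto
    moreover have "(\<Sum>m\<in>{n..<M} \<union> {M..M + n}. (norm (coeff U m))\<^sup>2) =
        (\<Sum>m\<in>{n..<M}. (norm (coeff U m))\<^sup>2) + (\<Sum>m\<in>{M..M + n}. (norm (coeff U m))\<^sup>2)"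
      by (rule sum.union_disjoint) auto
    moreover have "(\<Sum>m\<le>M + n. (norm (coeff U m))\<^sup>2) \<le> (1 + \<delta> M)\<^sup>2 * (\<Sum>k\<le>n. (norm (coeff P k))\<^sup>2)"
    proof (rule sum_norm_coeff_le)
      fix z :: complex assume "norm z = 1"
      then show "norm (poly U z) \<le> (1 + \<delta> M) * norm (poly P z)"
        using mult_right_mono[OF W_le[of z M] norm_ge_zero[of "poly P z"]]
        by (simp add: U_def norm_mult mult.commute)
    qed (use \<delta>0 \<open>degree P \<le> n\<close> in auto)
    moreover have "(\<Sum>k\<le>n. (norm (coeff P k))\<^sup>2) = (\<Sum>i\<le>n. (p i)\<^sup>2)"
      by (intro sum.cong refl) (simp add: coeff_P)
    ultimately show ?thesis using A B by simp
  qed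
  \<comment> \<open>As \<open>M\<close> grows, \<open>\<delta> M\<close> and the missing part of the
    geometric series vanish, and \<open>bound\<close> passes to the limit.\<close>
  have inv: "\<bar>inverse \<theta>\<bar> < 1" using \<theta> by (simp add: inverse_less_1_iff)
  have "(\<lambda>M. inverse \<theta> ^ M) \<longlonglongrightarrow> 0" using inv by (intro LIMSEQ_power_zero) simp
  moreover have "(\<lambda>M. \<Sum>k. \<bar>e (k + Suc M)\<bar>) \<longlonglongrightarrow> 0"
    using suminf_exist_split2[OF e] by (rule LIMSEQ_Suc)
  ultimately have "(\<lambda>M. \<bar>\<rho>\<bar> * inverse \<theta> ^ M / (\<theta> - 1) + (\<Sum>k. \<bar>e (k + Suc M)\<bar>)) \<longlonglongrightarrow> \<bar>\<rho>\<bar> * 0 / (\<theta> - 1) + 0"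
    using \<theta> by (intro tendsto_add tendsto_divide tendsto_mult tendsto_const) auto
  then have "\<delta> \<longlonglongrightarrow> 0" by (simp add: \<delta>_def[abs_def])
  then have "(\<lambda>M. (1 + \<delta> M)\<^sup>2 * (\<Sum>i\<le>n. (p i)\<^sup>2)) \<longlonglongrightarrow> (1 + 0)\<^sup>2 * (\<Sum>i\<le>n. (p i)\<^sup>2)"
    by (intro tendsto_intros)
  moreover have "(\<lambda>M. c\<^sup>2 * (1 - (inverse \<theta> ^ 2) ^ (M - n)) / (\<theta>\<^sup>2 - 1) + S) \<longlonglongrightarrow> c\<^sup>2 * (1 - 0) / (\<theta>\<^sup>2 - 1) + S"
  proof (rule LIMSEQ_offset[of _ n], intro tendsto_intros)
    have "(\<lambda>M. (inverse \<theta> ^ 2) ^ M) \<longlonglongrightarrow> 0"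
      using inv by (intro LIMSEQ_power_zero) (simp add: abs_square_less_1 power_abs[symmetric])
    then show "(\<lambda>M. (inverse \<theta> ^ 2) ^ (M + n - n)) \<longlonglongrightarrow> 0" by simp
    show "\<theta>\<^sup>2 - 1 \<noteq> 0" using \<theta> by (simp add: power2_eq_1_iff)
  qed
  ultimately show ?thesis
    using LIMSEQ_le[of _ "c\<^sup>2 * (1 - 0) / (\<theta>\<^sup>2 - 1) + S" _ "(1 + 0)\<^sup>2 * (\<Sum>i\<le>n. (p i)\<^sup>2)"] bound
    by (fastforce simp: S_def)
qed

section \<open>Integer power series attached to a Pisot number\<close>

text \<open>The coefficients of \<open>A\<close> satisfy a recursion without division, since
  \<open>Q\<close> has constant coefficient 1.\<close>

lemma fps_nth_Ints_of_mult:
  fixes Q A F :: "'a :: comm_ring_1 fps"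
  assumes "Q * A = F" "fps_nth Q 0 = 1" "\<And>k. fps_nth Q k \<in> \<int>" "\<And>k. fps_nth F k \<in> \<int>"
  shows "fps_nth A k \<in> \<int>"
proof (induction k rule: less_induct)
  case (less k)
  have "fps_nth F k = (\<Sum>i=0..k. fps_nth Q i * fps_nth A (k - i))"
    by (simp add: assms(1)[symmetric] fps_mult_nth)
  also have "\<dots> = fps_nth A k + (\<Sum>i=Suc 0..k. fps_nth Q i * fps_nth A (k - i))"
    by (simp add: sum.atLeast_Suc_atMost assms)
  finally have "fps_nth A k = fps_nth F k - (\<Sum>i=Suc 0..k. fps_nth Q i * fps_nth A (k - i))"
    by simp
  moreover have "(\<Sum>i=Suc 0..k. fps_nth Q i * fps_nth A (k - i)) \<in> \<int>"
    by (intro Ints_sum Ints_mult assms less) auto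
  ultimately show ?case using assms(4) by simp
qed

text \<open>
  The function is \<open>\<plusminus>P / Q\<close> for the minimal polynomial \<open>P\<close> of \<open>\<theta>\<close> and its reciprocal \<open>Q\<close>: the constant
  coefficient of \<open>Q\<close> is 1, so the power series has integer coefficients, and \<open>1 / \<theta>\<close> is the only root
  of \<open>Q\<close> in the closed unit disc.
\<close>

lemma Pisot_expansion:
  assumes \<theta>: "Pisot \<theta>" "\<theta> < 2"
  obtains \<rho> :: real and a :: "nat \<Rightarrow> int" where "\<rho> \<noteq> 0" "a 0 \<ge> 1"
    "summable (\<lambda>k. \<bar>of_int (a k) - \<rho> * \<theta> ^ k\<bar>)"
    "\<And>z. norm z = 1 \<Longrightarrow> norm (of_real \<rho> / (1 - of_real \<theta> * z) +
      (\<Sum>k. of_real (of_int (a k) - \<rho> * \<theta> ^ k) * z ^ k :: complex)) = 1"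
proof -
  let ?t = "complex_of_real \<theta>" and ?i = "complex_of_real (inverse \<theta>)"
  have t1: "\<theta> > 1" using \<theta> by (simp add: Pisot_def)
  obtain P :: "int poly" where lead: "lead_coeff P = 1"
    and roots: "\<And>w. poly (map_poly of_int P) w = 0 \<Longrightarrow> w = ?t \<or> norm w < 1"
    and root: "poly (map_poly of_int P) ?t = 0"
    and simple: "poly (pderiv (map_poly of_int P)) ?t \<noteq> 0"
    and nz0: "poly (map_poly of_int P) (0 :: complex) \<noteq> 0"
    and nzi: "poly (map_poly of_int P) ?i \<noteq> 0"
    by (rule Pisot_polynomial[OF \<theta>], rule that) assumption+
  define f where "f = (map_poly of_int P :: complex poly)"
  have coeff_f: "coeff f k = of_int (coeff P k)" for k by (simp add: f_def coeff_map_poly)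
  have lead_f: "lead_coeff f = 1" using lead by (simp add: f_def degree_map_poly coeff_map_poly)
  have P0: "coeff P 0 \<noteq> 0" using nz0 by (simp add: poly_0_coeff_0 coeff_map_poly)
  \<comment> \<open>The sign makes the constant coefficient \<open>a 0\<close> equal to the absolute
    value of that of \<open>P\<close>.\<close>
  define s where "s = sgn (coeff P 0)"
  have s: "s = 1 \<or> s = - 1" using P0 by (auto simp: s_def sgn_if)
  define Q where "Q = reflect_poly f"
  have Q_eq: "poly Q z = z ^ degree f * poly f (inverse z)" if "z \<noteq> 0" for z
    using that by (simp add: Q_def poly_reflect_poly_nz)
  have Q0: "poly Q 0 = 1" by (simp add: Q_def lead_f)
  have lin: "[:1, - ?t:] = smult (- ?t) [:- ?i, 1:]" using t1 by simp
  have lin_dvd: "[:1, - ?t:] dvd g \<longleftrightarrow> poly g ?i = 0" for g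
    unfolding poly_eq_0_iff_dvd using t1 by (subst lin, subst smult_dvd_iff) simp
  have "poly Q ?i = 0" using root t1 by (simp add: Q_eq f_def)
  then obtain B where B: "Q = [:1, - ?t:] * B" using lin_dvd by (auto simp: dvd_def)
  have "f = reflect_poly Q" using nz0 by (simp add: Q_def f_def poly_0_coeff_0)
  also have "\<dots> = [:- ?t, 1:] * reflect_poly B"
    unfolding B reflect_poly_mult using t1 by (simp add: reflect_poly_pCons)
  finally have f_eq: "f = [:- ?t, 1:] * reflect_poly B" .
  have "poly (pderiv f) ?t = poly (reflect_poly B) ?t"
    by (subst f_eq, subst pderiv_mult, subst poly_add, subst (1 2) poly_mult) (simp add: pderiv_pCons)
  then have "poly (reflect_poly B) ?t \<noteq> 0" using simple by (simp add: f_def)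
  then have Bi: "poly B ?i \<noteq> 0" using t1 by (simp add: poly_reflect_poly_nz)
  \<comment> \<open>Roots of \<open>Q\<close> are inverses of roots of \<open>f\<close>. Only
    \<open>1 / \<theta>\<close> lies in the closed disc, and it is not a root of \<open>B\<close>
    because \<open>\<theta>\<close> is a simple root of \<open>f\<close>.\<close>
  have B_nz: "1 < norm z" if "poly B z = 0" for z
  proof (rule ccontr)
    assume z: "\<not> 1 < norm z"
    have "poly Q z = 0" using that by (simp add: B)
    then have "z \<noteq> 0" using Q0 by auto
    then have "poly f (inverse z) = 0" using \<open>poly Q z = 0\<close> by (simp add: Q_eq)
    moreover have "\<not> norm (inverse z) < 1"
      using z \<open>z \<noteq> 0\<close> by (simp add: norm_inverse inverse_less_1_iff not_less)
    ultimately have "inverse z = ?t" using roots by (auto simp: f_def)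
    then have "z = ?i" by (metis inverse_inverse_eq of_real_inverse)
    then show False using that Bi by simp
  qed
  have "B \<noteq> 0" using Bi by auto
  \<comment> \<open>A radius above 1 within which \<open>B\<close> has no root; the element 2 keeps
    the minimum meaningful when \<open>B\<close> has no roots at all.\<close>
  define R where "R = Min (insert 2 (norm ` {z. poly B z = 0}))"
  have fin: "finite (insert 2 (norm ` {z. poly B z = 0}))" using \<open>B \<noteq> 0\<close> by (simp add: poly_roots_finite)
  have "R > 1" using fin B_nz by (simp add: R_def)
  have R_le: "R \<le> norm z" if "poly B z = 0" for z
    using fin that by (auto simp: R_def intro: Min_le)
  \<comment> \<open>Chosen so that \<open>s f - r B\<close> vanishes at \<open>1 / \<theta>\<close>:
    subtracting \<open>r / (1 - \<theta> z)\<close> from \<open>s f / Q\<close> removes the pole and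
    leaves \<open>N / B\<close>.\<close>
  define r where "r = of_int s * poly f ?i / poly B ?i"
  have "poly (smult (of_int s) f - smult r B) ?i = 0" using Bi by (simp add: r_def)
  then have "[:1, - ?t:] dvd smult (of_int s) f - smult r B" by (simp only: lin_dvd)
  then obtain N where N: "smult (of_int s) f - smult r B = [:1, - ?t:] * N" by (elim dvdE)
  define E where "E = fps_of_poly N / fps_of_poly B"
  have B_fps: "eval_fps (fps_of_poly B) z \<noteq> 0" if "z \<in> eball 0 (ereal R)" for z
    using that R_le[of z] by (auto simp: in_eball_iff)
  have radius: "fps_conv_radius E \<ge> R"
    unfolding E_def using fps_conv_radius_divide'[of "fps_of_poly N" "fps_of_poly B" "ereal R"] B_fps \<open>R > 1\<close>
    by (simp add: one_ereal_def)
  have eval_E: "eval_fps E z = poly N z / poly B z" if "norm z < R" for z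
    unfolding E_def using eval_fps_divide'[of "fps_of_poly N" "fps_of_poly B" "ereal R" z] B_fps \<open>R > 1\<close> that
    by (simp add: one_ereal_def)
  have summable_E: "summable (\<lambda>k. norm (fps_nth E k * z ^ k))" if "norm z = 1" for z
    by (rule norm_summable_fps) (use that radius \<open>R > 1\<close> in \<open>metis ereal_less(3) less_ereal.simps(1) less_le_trans one_ereal_def\<close>)
  define G where "G = Abs_fps (\<lambda>k. r * ?t ^ k)"
  define A where "A = E + G"
  have "poly B 0 = 1" using Q0 by (simp add: B)
  then have BE: "fps_of_poly B * E = fps_of_poly N"
    unfolding E_def
    by (simp add: fps_divide_unit poly_0_coeff_0 mult.left_commute[of "fps_of_poly B"] inverse_mult_eq_1')
  have lin_G: "fps_of_poly [:1, - ?t:] * G = fps_const r"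
  proof (rule fps_ext)
    fix k
    have "fps_of_poly [:1, - ?t:] = 1 - fps_const ?t * fps_X"
      by (simp add: fps_of_poly_pCons)
    then have "fps_of_poly [:1, - ?t:] * G = G - fps_const ?t * (fps_X * G)"
      by (simp only: left_diff_distrib mult.assoc mult_1_left)
    then show "fps_nth (fps_of_poly [:1, - ?t:] * G) k = fps_nth (fps_const r) k"
      by (cases k) (simp_all add: G_def)
  qed
  have "fps_of_poly Q * A = fps_of_poly [:1, - ?t:] * (fps_of_poly B * E) + fps_of_poly B * (fps_of_poly [:1, - ?t:] * G)"
    unfolding A_def B fps_of_poly_mult by (simp only: distrib_left distrib_right mult_ac)
  also have "\<dots> = fps_of_poly ([:1, - ?t:] * N + smult r B)"
    unfolding BE lin_G fps_of_poly_add fps_of_poly_mult fps_of_poly_smult by (simp only: mult.commute)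
  also have "[:1, - ?t:] * N + smult r B = smult (of_int s) f"
    unfolding N[symmetric] by simp
  finally have QA: "fps_of_poly Q * A = fps_of_poly (smult (of_int s) f)" .
  have "fps_nth A k \<in> \<int>" for k
  proof (rule fps_nth_Ints_of_mult[OF QA])
    show "fps_nth (fps_of_poly Q) 0 = 1" using Q0 by (simp add: poly_0_coeff_0)
  qed (simp_all add: Q_def coeff_reflect_poly coeff_f)
  then have "\<forall>k. \<exists>m. fps_nth A k = of_int m" by (auto elim: Ints_cases)
  then obtain a where a: "\<And>k. fps_nth A k = of_int (a k)" by metis
  have E_a: "fps_nth E k = of_int (a k) - r * ?t ^ k" for k
    using a[of k] by (simp add: A_def G_def eq_diff_eq)
  \<comment> \<open>The coefficients of \<open>E\<close> tend to 0, but since \<open>a k\<close> is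
    an integer their imaginary parts are \<open>- Im r * \<theta> ^ k\<close>.\<close>
  have "Im r = 0"
  proof -
    have "(\<lambda>k. norm (fps_nth E k)) \<longlonglongrightarrow> 0"
      using summable_LIMSEQ_zero[OF summable_E[of 1]] by simp
    moreover have "\<bar>Im r\<bar> \<le> norm (fps_nth E k)" for k
    proof -
      have "Im (fps_nth E k) = - (Im r * \<theta> ^ k)" by (simp add: E_a flip: of_real_power)
      moreover have "\<bar>Im r\<bar> * 1 \<le> \<bar>Im r\<bar> * \<theta> ^ k" using t1 by (intro mult_left_mono) simp_all
      ultimately have "\<bar>Im r\<bar> \<le> \<bar>Im (fps_nth E k)\<bar>" using t1 by (simp add: abs_mult)
      then show ?thesis using abs_Im_le_cmod order_trans by blast
    qed
    ultimately have "\<bar>Im r\<bar> \<le> 0" by (intro LIMSEQ_le_const) auto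
    then show ?thesis by simp
  qed
  then obtain \<rho> where \<rho>: "r = of_real \<rho>" by (metis complex_is_Real_iff Reals_cases)
  have E_\<rho>: "fps_nth E k = of_real (of_int (a k) - \<rho> * \<theta> ^ k)" for k
    by (simp add: E_a \<rho>)
  show ?thesis
  proof (rule that)
    show "\<rho> \<noteq> 0" using nzi Bi s \<rho> by (auto simp: r_def f_def)
    have "fps_nth (fps_of_poly Q * A) 0 = of_int (s * coeff P 0)" by (simp add: QA coeff_f)
    then have "of_int (a 0) = (of_int (s * coeff P 0) :: complex)"
      using Q0 by (simp add: fps_mult_nth a poly_0_coeff_0)
    then have "a 0 = s * coeff P 0" by (simp only: of_int_eq_iff)
    then show "1 \<le> a 0" using P0 by (simp add: s_def sgn_if)
    show "summable (\<lambda>k. \<bar>of_int (a k) - \<rho> * \<theta> ^ k\<bar>)"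
      using summable_E[of 1] by (simp only: E_\<rho> norm_of_real norm_mult) simp
    fix z :: complex assume z: "norm z = 1"
    then have "z \<noteq> 0" by auto
    have "poly f z \<noteq> 0" using roots[of z] z t1 by (auto simp: f_def)
    \<comment> \<open>On the circle inversion is conjugation, and \<open>f\<close> has real
      coefficients, so \<open>Q\<close> and \<open>f\<close> have equal modulus there.\<close>
    have "cnj z = inverse z" using complex_norm_square[of z] z by (intro inverse_unique[symmetric]) simp
    moreover have "poly f (cnj z) = cnj (poly f z)" by (rule poly_cnj_real[symmetric]) (simp add: coeff_f)
    ultimately have "norm (poly Q z) = norm (poly f z)"
      using z \<open>z \<noteq> 0\<close> by (simp add: Q_eq norm_mult norm_power)
    have "poly B z \<noteq> 0" using B_nz[of z] z by auto
    have QB: "poly Q z = (1 - ?t * z) * poly B z" by (simp add: B algebra_simps)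
    have "poly Q z \<noteq> 0"
      using \<open>norm (poly Q z) = norm (poly f z)\<close> \<open>poly f z \<noteq> 0\<close> by auto
    then have "1 - ?t * z \<noteq> 0" unfolding QB mult_eq_0_iff by simp
    have "of_int s * poly f z - r * poly B z = (1 - ?t * z) * poly N z"
      using arg_cong[OF N, of "\<lambda>g. poly g z"] by (simp add: algebra_simps)
    then have "poly N z = (of_int s * poly f z - r * poly B z) / (1 - ?t * z)"
      using \<open>1 - ?t * z \<noteq> 0\<close> by (simp add: eq_divide_eq mult.commute)
    then have "r / (1 - ?t * z) + poly N z / poly B z = of_int s * poly f z / ((1 - ?t * z) * poly B z)"
    proof -
      have "u / d + (x - u * b) / d / b = x / (d * b)" if "b \<noteq> 0" for u d x b :: complex
        using that by (simp add: diff_divide_distrib)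
      then show ?thesis using \<open>poly N z = _\<close> \<open>poly B z \<noteq> 0\<close> by (simp only: not_False_eq_True)
    qed
    also note QB[symmetric]
    finally have "norm (r / (1 - ?t * z) + poly N z / poly B z) = 1"
      using s \<open>norm (poly Q z) = norm (poly f z)\<close> \<open>poly f z \<noteq> 0\<close> by (auto simp: norm_divide norm_mult)
    moreover have "poly N z / poly B z = (\<Sum>k. of_real (of_int (a k) - \<rho> * \<theta> ^ k) * z ^ k)"
      using eval_E[of z] z \<open>R > 1\<close> by (simp add: eval_fps_def E_\<rho>)
    ultimately show "norm (of_real \<rho> / (1 - of_real \<theta> * z) +
      (\<Sum>k. of_real (of_int (a k) - \<rho> * \<theta> ^ k) * z ^ k)) = 1" by (simp only: \<rho>)
  qed
qed

text \<open>Expanding the squares of the preceding bound and summing the powers of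
  \<open>\<theta>\<^sup>2\<close> turns it into a quadratic inequality in
  \<open>\<rho> * (\<Sum>i\<le>n. p i / \<theta> ^ i)\<close> whose other data are the integers
  \<open>a k\<close>.\<close>

lemma Pisot_coefficients:
  assumes \<theta>: "Pisot \<theta>" "\<theta> < 2"
  obtains \<rho> :: real and a :: "nat \<Rightarrow> int" where "\<rho> > 0" "a 0 \<ge> 1"
    "\<And>(p :: nat \<Rightarrow> real) n. (\<Sum>k\<le>n. (\<Sum>i\<le>k. p i * of_int (a (k - i)))\<^sup>2) - (\<Sum>i\<le>n. (p i)\<^sup>2)
      \<le> 2 * (\<rho> * (\<Sum>i\<le>n. p i / \<theta> ^ i)) * (\<Sum>k\<le>n. (\<Sum>i\<le>k. p i * of_int (a (k - i))) * \<theta> ^ k)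
        - (\<rho> * (\<Sum>i\<le>n. p i / \<theta> ^ i))\<^sup>2 * \<theta> ^ (2 * n + 2) / (\<theta>\<^sup>2 - 1)"
proof -
  have t1: "\<theta> > 1" using \<theta> by (simp add: Pisot_def)
  then have t2: "\<theta>\<^sup>2 > 1" by simp
  obtain \<rho> a where a: "\<rho> \<noteq> 0" "a 0 \<ge> 1"
    "summable (\<lambda>k. \<bar>of_int (a k) - \<rho> * \<theta> ^ k\<bar>)"
    "\<And>z. norm z = 1 \<Longrightarrow> norm (of_real \<rho> / (1 - of_real \<theta> * z) +
      (\<Sum>k. of_real (of_int (a k) - \<rho> * \<theta> ^ k) * z ^ k :: complex)) = 1"
    by (rule Pisot_expansion[OF \<theta>], rule that) assumption+
  have bound: "(\<Sum>k\<le>n. (\<Sum>i\<le>k. p i * of_int (a (k - i)))\<^sup>2) - (\<Sum>i\<le>n. (p i)\<^sup>2)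
      \<le> 2 * (\<rho> * (\<Sum>i\<le>n. p i / \<theta> ^ i)) * (\<Sum>k\<le>n. (\<Sum>i\<le>k. p i * of_int (a (k - i))) * \<theta> ^ k)
        - (\<rho> * (\<Sum>i\<le>n. p i / \<theta> ^ i))\<^sup>2 * \<theta> ^ (2 * n + 2) / (\<theta>\<^sup>2 - 1)" for p n
  proof -
    define c where "c = \<rho> * (\<Sum>i\<le>n. p i / \<theta> ^ i)"
    define h where "h k = (\<Sum>i\<le>k. p i * of_int (a (k - i)))" for k
    have "c\<^sup>2 / (\<theta>\<^sup>2 - 1) + (\<Sum>k\<le>n. (h k - c * \<theta> ^ k)\<^sup>2) \<le> (\<Sum>i\<le>n. (p i)\<^sup>2)"
      using unimodular_expansion_bound[OF t1 a(3,4), of p n] by (simp add: c_def h_def)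
    moreover have "(\<Sum>k\<le>n. (h k - c * \<theta> ^ k)\<^sup>2) = (\<Sum>k\<le>n. (h k)\<^sup>2) - 2 * c * (\<Sum>k\<le>n. h k * \<theta> ^ k) + c\<^sup>2 * (\<Sum>k\<le>n. (\<theta>\<^sup>2) ^ k)"
      by (simp add: power2_diff sum.distrib sum_subtractf sum_distrib_left power_mult_distrib mult_ac flip: power_mult)
    moreover have "c\<^sup>2 / (\<theta>\<^sup>2 - 1) + c\<^sup>2 * (\<Sum>k\<le>n. (\<theta>\<^sup>2) ^ k) = c\<^sup>2 * \<theta> ^ (2 * n + 2) / (\<theta>\<^sup>2 - 1)"
    proof -
      have "(\<Sum>k\<le>n. (\<theta>\<^sup>2) ^ k) = ((\<theta>\<^sup>2) ^ Suc n - 1) / (\<theta>\<^sup>2 - 1)"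
        using t2 geometric_sum[of "\<theta>\<^sup>2" "Suc n"] by (simp add: lessThan_Suc_atMost)
      then have "c\<^sup>2 / (\<theta>\<^sup>2 - 1) + c\<^sup>2 * (\<Sum>k\<le>n. (\<theta>\<^sup>2) ^ k) = (c\<^sup>2 + c\<^sup>2 * ((\<theta>\<^sup>2) ^ Suc n - 1)) / (\<theta>\<^sup>2 - 1)"
        by (simp only: add_divide_distrib times_divide_eq_right)
      also have "c\<^sup>2 + c\<^sup>2 * ((\<theta>\<^sup>2) ^ Suc n - 1) = c\<^sup>2 * (\<theta>\<^sup>2) ^ Suc n" by (simp add: right_diff_distrib)
      also have "(\<theta>\<^sup>2) ^ Suc n = \<theta> ^ (2 * n + 2)" by (metis power_mult mult_Suc_right add.commute)
      finally show ?thesis .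
    qed
    ultimately show ?thesis unfolding c_def[symmetric] h_def[symmetric] by linarith
  qed
  \<comment> \<open>For the constant polynomial 1 the left side is nonnegative, while the right side
    would be negative if \<open>\<rho>\<close> were.\<close>
  have "\<rho> > 0"
  proof (rule ccontr)
    assume "\<not> \<rho> > 0"
    have "(of_int (a 0))\<^sup>2 - 1 \<le> 2 * \<rho> * of_int (a 0) - \<rho>\<^sup>2 * \<theta>\<^sup>2 / (\<theta>\<^sup>2 - 1)"
      using bound[where p = "\<lambda>_. 1" and n = 0] by (simp add: power2_eq_square)
    moreover have "1 \<le> (real_of_int (a 0))\<^sup>2" using a(2) by simp
    moreover have "\<rho> * real_of_int (a 0) \<le> 0" using a(2) \<open>\<not> \<rho> > 0\<close> by (simp add: mult_nonpos_nonneg)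
    moreover have "0 < \<rho>\<^sup>2 * \<theta>\<^sup>2 / (\<theta>\<^sup>2 - 1)" using a(1) t1 t2 by simp
    ultimately show False by linarith
  qed
  from this a(2) bound show ?thesis by (rule that)
qed

section \<open>The two smallest Pisot numbers\<close>

text \<open>The bound on \<open>D\<close> is a concave quadratic in \<open>c\<close> with maximum
  \<open>H\<^sup>2 * w / K\<close>. This eliminates the unknown \<open>\<rho>\<close>.\<close>

lemma quadratic_max_le:
  fixes c D H K w :: real
  assumes "D \<le> 2 * c * H - c\<^sup>2 * K / w" "0 < K" "0 < w"
  shows "D * K \<le> H\<^sup>2 * w"
proof -
  have "D * (K * w) \<le> (2 * c * H - c\<^sup>2 * K / w) * (K * w)"
    using assms by (intro mult_right_mono) auto
  also have "\<dots> = 2 * c * H * (K * w) - c\<^sup>2 * K\<^sup>2"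
    using assms(3) by (simp add: left_diff_distrib power2_eq_square)
  also have "\<dots> = (H * w)\<^sup>2 - (c * K - H * w)\<^sup>2"
    by (simp add: power2_eq_square algebra_simps)
  also have "\<dots> \<le> (H * w)\<^sup>2" by simp
  finally have "(D * K) * w \<le> (H\<^sup>2 * w) * w" by (simp add: power2_eq_square mult_ac)
  then show ?thesis using assms(3) by simp
qed

text \<open>If \<open>c\<close> and \<open>H\<close> have opposite signs, the quadratic is negative
  for every nonzero \<open>c\<close>.\<close>

lemma quadratic_sign:
  fixes c D H K w :: real
  assumes "D \<le> 2 * c * H - c\<^sup>2 * K / w" "0 < K" "0 < w" "c * H \<le> 0" "0 \<le> D"
  shows "c = 0"
proof (rule ccontr)
  assume "c \<noteq> 0"
  then have "0 < c\<^sup>2 * K / w" using assms by simp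
  then show False using assms by linarith
qed

lemma Pisot_first_coefficients:
  fixes \<theta> :: real
  assumes \<theta>: "Pisot \<theta>" "\<theta> < 2"
  obtains \<rho> a0 a1 a2 a3 :: real where "\<rho> > 0" "a0 \<ge> 1" "{a0, a1, a2, a3} \<subseteq> \<int>"
    "a0\<^sup>2 - 1 \<le> 2 * \<rho> * a0 - \<rho>\<^sup>2 * \<theta>\<^sup>2 / (\<theta>\<^sup>2 - 1)"
    "\<And>p0 p1 :: real. p0\<^sup>2 * a0\<^sup>2 + (p0 * a1 + p1 * a0)\<^sup>2 - (p0\<^sup>2 + p1\<^sup>2)
      \<le> 2 * (\<rho> * (p0 + p1 / \<theta>)) * (p0 * a0 + (p0 * a1 + p1 * a0) * \<theta>)
        - (\<rho> * (p0 + p1 / \<theta>))\<^sup>2 * \<theta> ^ 4 / (\<theta>\<^sup>2 - 1)"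
    "\<And>p0 p1 p2 :: real. p0\<^sup>2 * a0\<^sup>2 + (p0 * a1 + p1 * a0)\<^sup>2 + (p0 * a2 + p1 * a1 + p2 * a0)\<^sup>2 - (p0\<^sup>2 + p1\<^sup>2 + p2\<^sup>2)
      \<le> 2 * (\<rho> * (p0 + p1 / \<theta> + p2 / \<theta>\<^sup>2)) * (p0 * a0 + (p0 * a1 + p1 * a0) * \<theta> + (p0 * a2 + p1 * a1 + p2 * a0) * \<theta>\<^sup>2)
        - (\<rho> * (p0 + p1 / \<theta> + p2 / \<theta>\<^sup>2))\<^sup>2 * \<theta> ^ 6 / (\<theta>\<^sup>2 - 1)"
    "\<And>p0 p1 p2 p3 :: real. p0\<^sup>2 * a0\<^sup>2 + (p0 * a1 + p1 * a0)\<^sup>2 + (p0 * a2 + p1 * a1 + p2 * a0)\<^sup>2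
        + (p0 * a3 + p1 * a2 + p2 * a1 + p3 * a0)\<^sup>2 - (p0\<^sup>2 + p1\<^sup>2 + p2\<^sup>2 + p3\<^sup>2)
      \<le> 2 * (\<rho> * (p0 + p1 / \<theta> + p2 / \<theta>\<^sup>2 + p3 / \<theta> ^ 3)) * (p0 * a0 + (p0 * a1 + p1 * a0) * \<theta>
          + (p0 * a2 + p1 * a1 + p2 * a0) * \<theta>\<^sup>2 + (p0 * a3 + p1 * a2 + p2 * a1 + p3 * a0) * \<theta> ^ 3)
        - (\<rho> * (p0 + p1 / \<theta> + p2 / \<theta>\<^sup>2 + p3 / \<theta> ^ 3))\<^sup>2 * \<theta> ^ 8 / (\<theta>\<^sup>2 - 1)"
proof -
  obtain \<rho> a where a: "\<rho> > 0" "a 0 \<ge> 1" and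
    bound: "\<And>(p :: nat \<Rightarrow> real) n. (\<Sum>k\<le>n. (\<Sum>i\<le>k. p i * of_int (a (k - i)))\<^sup>2) - (\<Sum>i\<le>n. (p i)\<^sup>2)
      \<le> 2 * (\<rho> * (\<Sum>i\<le>n. p i / \<theta> ^ i)) * (\<Sum>k\<le>n. (\<Sum>i\<le>k. p i * of_int (a (k - i))) * \<theta> ^ k)
        - (\<rho> * (\<Sum>i\<le>n. p i / \<theta> ^ i))\<^sup>2 * \<theta> ^ (2 * n + 2) / (\<theta>\<^sup>2 - 1)"
    by (rule Pisot_coefficients[OF \<theta>], rule that) assumption+
  have sums: "(\<Sum>k\<le>(1::nat). g k) = g 0 + g 1" "(\<Sum>k\<le>(2::nat). g k) = g 0 + g 1 + g 2"
      "(\<Sum>k\<le>(3::nat). g k) = g 0 + g 1 + g 2 + g 3" for g :: "nat \<Rightarrow> real"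
    by (simp_all add: eval_nat_numeral)
  show ?thesis
  proof (rule that[of \<rho> "real_of_int (a 0)" "real_of_int (a 1)" "real_of_int (a 2)" "real_of_int (a 3)"])
    show "\<rho> > 0" "real_of_int (a 0) \<ge> 1" "{real_of_int (a 0), a 1, a 2, a 3} \<subseteq> \<int>"
      using a by auto
    show "(real_of_int (a 0))\<^sup>2 - 1 \<le> 2 * \<rho> * a 0 - \<rho>\<^sup>2 * \<theta>\<^sup>2 / (\<theta>\<^sup>2 - 1)"
      using bound[where p = "\<lambda>_. 1" and n = 0] by (simp add: power2_eq_square)
    fix p0 p1 p2 p3 :: real
    show "p0\<^sup>2 * (real_of_int (a 0))\<^sup>2 + (p0 * a 1 + p1 * a 0)\<^sup>2 - (p0\<^sup>2 + p1\<^sup>2)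
      \<le> 2 * (\<rho> * (p0 + p1 / \<theta>)) * (p0 * a 0 + (p0 * a 1 + p1 * a 0) * \<theta>)
        - (\<rho> * (p0 + p1 / \<theta>))\<^sup>2 * \<theta> ^ 4 / (\<theta>\<^sup>2 - 1)"
      using bound[where p = "(!) [p0, p1]" and n = 1]
      by (simp add: sums power_mult_distrib)
    show "p0\<^sup>2 * (real_of_int (a 0))\<^sup>2 + (p0 * a 1 + p1 * a 0)\<^sup>2 + (p0 * a 2 + p1 * a 1 + p2 * a 0)\<^sup>2 - (p0\<^sup>2 + p1\<^sup>2 + p2\<^sup>2)
      \<le> 2 * (\<rho> * (p0 + p1 / \<theta> + p2 / \<theta>\<^sup>2)) * (p0 * a 0 + (p0 * a 1 + p1 * a 0) * \<theta> + (p0 * a 2 + p1 * a 1 + p2 * a 0) * \<theta>\<^sup>2)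
        - (\<rho> * (p0 + p1 / \<theta> + p2 / \<theta>\<^sup>2))\<^sup>2 * \<theta> ^ 6 / (\<theta>\<^sup>2 - 1)"
      using bound[where p = "(!) [p0, p1, p2]" and n = 2]
      by (simp add: sums power_mult_distrib)
    show "p0\<^sup>2 * (real_of_int (a 0))\<^sup>2 + (p0 * a 1 + p1 * a 0)\<^sup>2 + (p0 * a 2 + p1 * a 1 + p2 * a 0)\<^sup>2
        + (p0 * a 3 + p1 * a 2 + p2 * a 1 + p3 * a 0)\<^sup>2 - (p0\<^sup>2 + p1\<^sup>2 + p2\<^sup>2 + p3\<^sup>2)
      \<le> 2 * (\<rho> * (p0 + p1 / \<theta> + p2 / \<theta>\<^sup>2 + p3 / \<theta> ^ 3)) * (p0 * a 0 + (p0 * a 1 + p1 * a 0) * \<theta>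
          + (p0 * a 2 + p1 * a 1 + p2 * a 0) * \<theta>\<^sup>2 + (p0 * a 3 + p1 * a 2 + p2 * a 1 + p3 * a 0) * \<theta> ^ 3)
        - (\<rho> * (p0 + p1 / \<theta> + p2 / \<theta>\<^sup>2 + p3 / \<theta> ^ 3))\<^sup>2 * \<theta> ^ 8 / (\<theta>\<^sup>2 - 1)"
      using bound[where p = "(!) [p0, p1, p2, p3]" and n = 3]
      by (simp add: sums power_mult_distrib)
  qed
qed

lemma Ints_le_0_or:
  assumes "x \<in> \<int>"
  shows "x \<le> 0 \<or> x = 1 \<or> x \<ge> (2 :: real)" "x = 2 \<or> x \<le> 1 \<or> x \<ge> (3 :: real)"
  using assms by (auto elim!: Ints_cases)

text \<open>
  Each step tests the quadratic inequality on one polynomial \<open>p0 + p1 z + p2 z\<^sup>2 + p3 z\<^sup>3\<close>. For \<open>a3 = 1\<close> it is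
  the reciprocal \<open>1 - z\<^sup>2 - z\<^sup>3\<close> of the cubic. For \<open>a3 = 2\<close> it is what \<open>(1 - z - z\<^sup>4) / (1 - \<theta> z)\<close>
  would be if \<open>\<theta>\<close> were the root of the quartic.
\<close>

lemma Pisot_small_cases:
  assumes \<theta>: "Pisot \<theta>" and le: "\<theta> ^ 4 \<le> \<theta> ^ 3 + 1"
  shows "\<theta> ^ 3 = \<theta> + 1 \<or> \<theta> ^ 4 = \<theta> ^ 3 + 1"
proof -
  have t1: "1 < \<theta>" using \<theta> by (simp add: Pisot_def)
  \<comment> \<open>The bound lies just above the root 1.3803 of the quartic, and
    \<open>x ^ 3 * (x - 1)\<close> already exceeds 1 there.\<close>
  have t2: "\<theta> < 1381 / 1000"
  proof (rule ccontr)
    assume "\<not> \<theta> < 1381 / 1000"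
    then have ge: "1381 / 1000 \<le> \<theta>" by simp
    then have "(1381 / 1000) ^ 3 * (1381 / 1000 - 1) \<le> \<theta> ^ 3 * (\<theta> - 1)"
      by (intro mult_mono power_mono) auto
    also have "\<dots> = \<theta> ^ 4 - \<theta> ^ 3" by (simp add: algebra_simps eval_nat_numeral)
    finally show False using le by (simp add: eval_nat_numeral)
  qed
  define w where "w = \<theta>\<^sup>2 - 1"
  have w: "0 < w" using t1 by (simp add: w_def)
  have pos: "0 < \<theta> ^ n" for n using t1 by simp
  have t2': "\<theta> < 2" using t2 by simp
  obtain \<rho> a0 a1 a2 a3 where \<rho>: "\<rho> > 0" and a0_ge: "a0 \<ge> 1" and ints: "{a0, a1, a2, a3} \<subseteq> \<int>"
    and b0: "a0\<^sup>2 - 1 \<le> 2 * \<rho> * a0 - \<rho>\<^sup>2 * \<theta>\<^sup>2 / (\<theta>\<^sup>2 - 1)"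
    and b1: "\<And>p0 p1. p0\<^sup>2 * a0\<^sup>2 + (p0 * a1 + p1 * a0)\<^sup>2 - (p0\<^sup>2 + p1\<^sup>2)
      \<le> 2 * (\<rho> * (p0 + p1 / \<theta>)) * (p0 * a0 + (p0 * a1 + p1 * a0) * \<theta>)
        - (\<rho> * (p0 + p1 / \<theta>))\<^sup>2 * \<theta> ^ 4 / (\<theta>\<^sup>2 - 1)"
    and b2: "\<And>p0 p1 p2. p0\<^sup>2 * a0\<^sup>2 + (p0 * a1 + p1 * a0)\<^sup>2 + (p0 * a2 + p1 * a1 + p2 * a0)\<^sup>2 - (p0\<^sup>2 + p1\<^sup>2 + p2\<^sup>2)
      \<le> 2 * (\<rho> * (p0 + p1 / \<theta> + p2 / \<theta>\<^sup>2)) * (p0 * a0 + (p0 * a1 + p1 * a0) * \<theta> + (p0 * a2 + p1 * a1 + p2 * a0) * \<theta>\<^sup>2)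
        - (\<rho> * (p0 + p1 / \<theta> + p2 / \<theta>\<^sup>2))\<^sup>2 * \<theta> ^ 6 / (\<theta>\<^sup>2 - 1)"
    and b3: "\<And>p0 p1 p2 p3. p0\<^sup>2 * a0\<^sup>2 + (p0 * a1 + p1 * a0)\<^sup>2 + (p0 * a2 + p1 * a1 + p2 * a0)\<^sup>2
        + (p0 * a3 + p1 * a2 + p2 * a1 + p3 * a0)\<^sup>2 - (p0\<^sup>2 + p1\<^sup>2 + p2\<^sup>2 + p3\<^sup>2)
      \<le> 2 * (\<rho> * (p0 + p1 / \<theta> + p2 / \<theta>\<^sup>2 + p3 / \<theta> ^ 3)) * (p0 * a0 + (p0 * a1 + p1 * a0) * \<theta>
          + (p0 * a2 + p1 * a1 + p2 * a0) * \<theta>\<^sup>2 + (p0 * a3 + p1 * a2 + p2 * a1 + p3 * a0) * \<theta> ^ 3)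
        - (\<rho> * (p0 + p1 / \<theta> + p2 / \<theta>\<^sup>2 + p3 / \<theta> ^ 3))\<^sup>2 * \<theta> ^ 8 / (\<theta>\<^sup>2 - 1)"
    by (rule Pisot_first_coefficients[OF \<theta> t2'], rule that) assumption+
  note b0 = b0[folded w_def] and b1 = b1[folded w_def] and b2 = b2[folded w_def] and b3 = b3[folded w_def]
  \<comment> \<open>Comparing neighbouring powers lets linear arithmetic treat the powers of
    \<open>\<theta>\<close> as separate unknowns.\<close>
  have drop: "\<theta> ^ Suc n \<le> 1381 / 1000 * \<theta> ^ n" for n
    using t2 pos[of n] by (simp add: mult_right_mono)
  have grow: "\<theta> ^ n \<le> \<theta> ^ Suc n" for n
    using t1 pos[of n] by simp
  have drops: "\<theta> ^ 2 \<le> 1381 / 1000 * \<theta>" "\<theta> ^ 3 \<le> 1381 / 1000 * \<theta> ^ 2" "\<theta> ^ 4 \<le> 1381 / 1000 * \<theta> ^ 3" "\<theta> ^ 5 \<le> 1381 / 1000 * \<theta> ^ 4" "\<theta> ^ 6 \<le> 1381 / 1000 * \<theta> ^ 5" "\<theta> ^ 7 \<le> 1381 / 1000 * \<theta> ^ 6" "\<theta> ^ 8 \<le> 1381 / 1000 * \<theta> ^ 7"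
    using drop[of 1] drop[of 2] drop[of 3] drop[of 4] drop[of 5] drop[of 6] drop[of 7]
    by (simp_all add: eval_nat_numeral)
  have grows: "\<theta> \<le> \<theta> ^ 2" "\<theta> ^ 2 \<le> \<theta> ^ 3" "\<theta> ^ 3 \<le> \<theta> ^ 4" "\<theta> ^ 4 \<le> \<theta> ^ 5" "\<theta> ^ 5 \<le> \<theta> ^ 6" "\<theta> ^ 6 \<le> \<theta> ^ 7" "\<theta> ^ 7 \<le> \<theta> ^ 8" "\<theta> ^ 8 \<le> \<theta> ^ 9" "\<theta> ^ 9 \<le> \<theta> ^ 10"
    using grow[of 1] grow[of 2] grow[of 3] grow[of 4] grow[of 5] grow[of 6] grow[of 7] grow[of 8] grow[of 9]
    by (simp_all add: eval_nat_numeral)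

  have a0: "a0 = 1"
  proof -
    have "(a0\<^sup>2 - 1) * \<theta>\<^sup>2 \<le> a0\<^sup>2 * w"
      by (rule quadratic_max_le[where c = \<rho>]) (use b0 w t1 in simp_all)
    then have "a0\<^sup>2 \<le> \<theta>\<^sup>2" by (simp add: w_def algebra_simps)
    then have "a0 \<le> \<theta>" using t1 by (simp add: power2_le_iff_abs_le)
    then show ?thesis using Ints_le_0_or(1)[of a0] ints a0_ge t2 by auto
  qed

  \<comment> \<open>Test polynomials: 1 excludes \<open>a1 \<ge> 2\<close>, and \<open>1 - z\<close>
    excludes \<open>a1 \<le> 0\<close>.\<close>
  have a1: "a1 = 1"
  proof -
    have False if "a1 \<ge> 2"
    proof -
      have "a1\<^sup>2 * \<theta> ^ 4 \<le> (1 + a1 * \<theta>)\<^sup>2 * w"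
        by (rule quadratic_max_le[where c = \<rho>]) (use b1[of 1 0] w pos t1 a0 in simp_all)
      \<comment> \<open>Bounding 1 by \<open>a1 / 2\<close> makes \<open>a1\<close> a common factor,
        leaving an inequality in \<open>\<theta>\<close> alone.\<close>
      also have "\<dots> \<le> (a1 * (1 / 2 + \<theta>))\<^sup>2 * w"
        using that w t1 by (intro mult_right_mono power_mono) (auto simp: algebra_simps)
      finally have "a1\<^sup>2 * \<theta> ^ 4 \<le> a1\<^sup>2 * ((1 / 2 + \<theta>)\<^sup>2 * w)" by (simp add: power_mult_distrib)
      then have "\<theta> ^ 4 \<le> (1 / 2 + \<theta>)\<^sup>2 * w" using that by (simp add: mult_le_cancel_left)
      moreover have "4 * ((1 / 2 + \<theta>)\<^sup>2 * w) = (1 + 2 * \<theta>)\<^sup>2 * w"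
        by (simp add: power2_eq_square distrib_left distrib_right mult_ac)
      moreover have "(1 + 2 * \<theta>)\<^sup>2 * w = 4 * \<theta> ^ 4 + 4 * \<theta> ^ 3 - 3 * \<theta>\<^sup>2 - 4 * \<theta> - 1"
        unfolding w_def by algebra
      ultimately show False using drops t1 by linarith
    qed
    moreover have False if "a1 \<le> 0"
    proof -
      have "\<rho> * (1 + - 1 / \<theta>) = 0"
      proof (rule quadratic_sign)
        show "a1\<^sup>2 - 2 * a1 \<le> 2 * (\<rho> * (1 + - 1 / \<theta>)) * (1 + (a1 - 1) * \<theta>) - (\<rho> * (1 + - 1 / \<theta>))\<^sup>2 * \<theta> ^ 4 / w"
          using b1[of 1 "- 1"] by (simp add: a0 power2_eq_square algebra_simps)
        have "(a1 - 1) * \<theta> \<le> - 1 * \<theta>" using that t1 by (intro mult_right_mono) auto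
        then have "1 + (a1 - 1) * \<theta> \<le> 0" using t1 by simp
        then show "\<rho> * (1 + - 1 / \<theta>) * (1 + (a1 - 1) * \<theta>) \<le> 0"
          using \<rho> t1 by (intro mult_nonneg_nonpos) auto
        show "0 \<le> a1\<^sup>2 - 2 * a1" using that zero_le_power2[of a1] by linarith
      qed (use w t1 in auto)
      then show False using \<rho> t1 by (simp add: field_simps)
    qed
    ultimately show ?thesis using Ints_le_0_or(1)[of a1] ints by auto
  qed

  \<comment> \<open>Test polynomials: \<open>1 + z\<^sup>2\<close> excludes
    \<open>a2 \<ge> 2\<close>, and \<open>1 - z\<^sup>2\<close> excludes
    \<open>a2 \<le> 0\<close>.\<close>
  have a2: "a2 = 1"
  proof -
    have False if "a2 \<ge> 2"
    proof -
      have "(a2 + 1)\<^sup>2 * \<theta> ^ 6 \<le> (1 + \<theta> + (a2 + 1) * \<theta>\<^sup>2)\<^sup>2 * w"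
        by (rule quadratic_max_le[where c = "\<rho> * (1 + 0 / \<theta> + 1 / \<theta>\<^sup>2)"])
           (use b2[of 1 0 1] w pos t1 a0 a1 in simp_all)
      also have "\<dots> \<le> ((a2 + 1) * ((1 + \<theta>) / 3 + \<theta>\<^sup>2))\<^sup>2 * w"
      proof (intro mult_right_mono power_mono)
        have "3 * ((1 + \<theta>) / 3) \<le> (a2 + 1) * ((1 + \<theta>) / 3)"
          using that t1 by (intro mult_right_mono) auto
        then show "1 + \<theta> + (a2 + 1) * \<theta>\<^sup>2 \<le> (a2 + 1) * ((1 + \<theta>) / 3 + \<theta>\<^sup>2)"
          by (simp add: distrib_left)
      qed (use that w t1 in auto)
      finally have "(a2 + 1)\<^sup>2 * \<theta> ^ 6 \<le> (a2 + 1)\<^sup>2 * (((1 + \<theta>) / 3 + \<theta>\<^sup>2)\<^sup>2 * w)"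
        by (simp add: power_mult_distrib)
      then have "\<theta> ^ 6 \<le> ((1 + \<theta>) / 3 + \<theta>\<^sup>2)\<^sup>2 * w" using that by (simp add: mult_le_cancel_left)
      then have "9 * \<theta> ^ 6 \<le> (1 + \<theta> + 3 * \<theta>\<^sup>2)\<^sup>2 * w"
        by (simp add: power2_eq_square field_simps)
      also have "(1 + \<theta> + 3 * \<theta>\<^sup>2)\<^sup>2 * w
          = 9 * \<theta> ^ 6 + 6 * \<theta> ^ 5 - 2 * \<theta> ^ 4 - 4 * \<theta> ^ 3 - 6 * \<theta>\<^sup>2 - 2 * \<theta> - 1"
        unfolding w_def by algebra
      finally show False using drops t1 t2 by linarith
    qed
    moreover have False if "a2 \<le> 0"
    proof -
      define k where "k = 1 - a2"
      have k: "1 \<le> k" using that by (simp add: k_def)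
      have "k\<^sup>2 * \<theta> ^ 6 \<le> (1 + \<theta> - k * \<theta>\<^sup>2)\<^sup>2 * w"
        by (rule quadratic_max_le[where c = "\<rho> * (1 + 0 / \<theta> + - 1 / \<theta>\<^sup>2)"])
           (use b2[of 1 0 "- 1"] w pos t1 a0 a1 in \<open>simp_all add: k_def power2_commute algebra_simps\<close>)
      also have "\<dots> \<le> (k * \<theta>\<^sup>2)\<^sup>2 * w"
      proof (intro mult_right_mono)
        have "1 * \<theta>\<^sup>2 \<le> k * \<theta>\<^sup>2" using k by (intro mult_right_mono) auto
        moreover have "\<theta> \<le> \<theta>\<^sup>2" using grows by blast
        ultimately have "\<bar>1 + \<theta> - k * \<theta>\<^sup>2\<bar> \<le> k * \<theta>\<^sup>2" using t1 by linarith
        then show "(1 + \<theta> - k * \<theta>\<^sup>2)\<^sup>2 \<le> (k * \<theta>\<^sup>2)\<^sup>2" using abs_le_square_iff by fastforce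
      qed (use w in auto)
      also have "\<dots> = k\<^sup>2 * \<theta> ^ 6 - k\<^sup>2 * \<theta> ^ 4" unfolding w_def by algebra
      finally have "k\<^sup>2 * \<theta> ^ 4 \<le> 0" by simp
      moreover have "0 < k\<^sup>2 * \<theta> ^ 4" using k pos[of 4] by simp
      ultimately show False by simp
    qed
    ultimately show ?thesis using Ints_le_0_or(1)[of a2] ints by auto
  qed

  define A where "A = 1 + \<theta> + \<theta>\<^sup>2"
  have A: "0 < A" using t1 by (simp add: A_def add_pos_pos)
  have b3': "(2 + a3\<^sup>2) * \<theta> ^ 8 \<le> (A + a3 * \<theta> ^ 3)\<^sup>2 * w"
    by (rule quadratic_max_le[where c = \<rho>]) (use b3[of 1 0 0 0] w pos t1 a0 a1 a2 in \<open>simp_all add: A_def\<close>)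
  have "\<not> a3 \<ge> 3"
  proof
    assume k: "a3 \<ge> 3"
    \<comment> \<open>The difference of the sides of \<open>b3'\<close> is positive at
      \<open>a3 = 3\<close>; for larger \<open>a3\<close> it grows by a nonnegative multiple of
      \<open>a3 - 3\<close>, because \<open>A * w \<le> 3 * \<theta> ^ 3\<close>.\<close>
    have "A * w = \<theta> ^ 4 + \<theta> ^ 3 - \<theta> - 1" unfolding A_def w_def by algebra
    then have "A * w \<le> 3 * \<theta> ^ 3" using drops grows t1 by linarith
    have "(a3 - 3) * (2 * \<theta> ^ 3 * (A * w)) \<le> (a3 - 3) * (2 * \<theta> ^ 3 * (3 * \<theta> ^ 3))"
      using k t1 \<open>A * w \<le> 3 * \<theta> ^ 3\<close> by (intro mult_left_mono) auto
    also have "\<dots> \<le> (a3 - 3) * ((a3 + 3) * \<theta> ^ 6)"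
      using k pos[of 6] by (intro mult_left_mono) (auto simp flip: power_add)
    finally have "(a3 - 3) * (2 * \<theta> ^ 3 * (A * w)) \<le> (a3 - 3) * ((a3 + 3) * \<theta> ^ 6)" .
    moreover have "(2 + a3\<^sup>2) * \<theta> ^ 8 - (A + a3 * \<theta> ^ 3)\<^sup>2 * w
        = (a3 - 3) * ((a3 + 3) * \<theta> ^ 6) - (a3 - 3) * (2 * \<theta> ^ 3 * (A * w))
          + (11 * \<theta> ^ 8 - (A + 3 * \<theta> ^ 3)\<^sup>2 * w)"
      unfolding w_def by algebra
    moreover have "11 * \<theta> ^ 8 - (A + 3 * \<theta> ^ 3)\<^sup>2 * w
        = 2 * \<theta> ^ 8 - 6 * \<theta> ^ 7 + 2 * \<theta> ^ 6 - 2 * \<theta> ^ 5 + 4 * \<theta> ^ 4 + 6 * \<theta> ^ 3 + 2 * \<theta>\<^sup>2 + 2 * \<theta> + 1"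
      unfolding w_def A_def by algebra
    moreover have "0 < 2 * \<theta> ^ 8 - 6 * \<theta> ^ 7 + 2 * \<theta> ^ 6 - 2 * \<theta> ^ 5 + 4 * \<theta> ^ 4 + 6 * \<theta> ^ 3 + 2 * \<theta>\<^sup>2 + 2 * \<theta> + 1"
      using drops grows t1 t2 by linarith
    ultimately show False using b3' by linarith
  qed
  moreover have "\<not> a3 \<le> 0"
  proof
    assume k: "a3 \<le> 0"
    have "(A + a3 * \<theta> ^ 3)\<^sup>2 \<le> A\<^sup>2 + a3\<^sup>2 * \<theta> ^ 6"
    proof -
      have "2 * (a3 * (A * \<theta> ^ 3)) \<le> 0" using k A t1 by (simp add: mult_le_0_iff)
      then show ?thesis by (simp add: power2_sum power_mult_distrib mult_ac flip: power_mult)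
    qed
    then have "(2 + a3\<^sup>2) * \<theta> ^ 8 \<le> (A\<^sup>2 + a3\<^sup>2 * \<theta> ^ 6) * w"
      using b3' w by (meson mult_right_mono less_imp_le order_trans)
    also have "\<dots> = A\<^sup>2 * w + a3\<^sup>2 * \<theta> ^ 8 - a3\<^sup>2 * \<theta> ^ 6" unfolding w_def by algebra
    also have "\<dots> \<le> A\<^sup>2 * w + a3\<^sup>2 * \<theta> ^ 8" using pos[of 6] by simp
    finally have "2 * \<theta> ^ 8 - A\<^sup>2 * w \<le> 0" by (simp add: algebra_simps)
    \<comment> \<open>Expanded around 1, the only negative term is the linear one, and the constant
      2 outweighs it.\<close>
    moreover have "2 * \<theta> ^ 8 - A\<^sup>2 * w = 2 - 2 * (\<theta> - 1) + 11 * (\<theta> - 1)\<^sup>2 + 64 * (\<theta> - 1) ^ 3 + 113 * (\<theta> - 1) ^ 4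
        + 104 * (\<theta> - 1) ^ 5 + 55 * (\<theta> - 1) ^ 6 + 16 * (\<theta> - 1) ^ 7 + 2 * (\<theta> - 1) ^ 8"
      unfolding w_def A_def by algebra
    moreover have "0 \<le> (\<theta> - 1) ^ n" for n using t1 by simp
    moreover have "2 * (\<theta> - 1) < 2" using t2 by simp
    ultimately show False
      by (smt (verit, best))
  qed
  ultimately have "a3 = 1 \<or> a3 = 2"
    using Ints_le_0_or[of a3] ints by auto
  then show ?thesis
  proof
    assume a3: "a3 = 1"
    have c_eq: "1 + 0 / \<theta> + - 1 / \<theta>\<^sup>2 + - 1 / \<theta> ^ 3 = (\<theta> ^ 3 - \<theta> - 1) / \<theta> ^ 3"
      using t1 by (simp add: field_simps eval_nat_numeral)
    \<comment> \<open>For this polynomial both square sums are 3, and the two factors of the linear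
      term have opposite signs, so the cubic must vanish at \<open>\<theta>\<close>.\<close>
    have "\<rho> * ((\<theta> ^ 3 - \<theta> - 1) / \<theta> ^ 3) = 0"
    proof (rule quadratic_sign)
      show "0 \<le> 2 * (\<rho> * ((\<theta> ^ 3 - \<theta> - 1) / \<theta> ^ 3)) * (1 + \<theta> - \<theta> ^ 3) - (\<rho> * ((\<theta> ^ 3 - \<theta> - 1) / \<theta> ^ 3))\<^sup>2 * \<theta> ^ 8 / w"
        using b3[of 1 0 "- 1" "- 1", unfolded c_eq] by (simp add: a0 a1 a2 a3)
      have "\<rho> * ((\<theta> ^ 3 - \<theta> - 1) / \<theta> ^ 3) * (1 + \<theta> - \<theta> ^ 3) = - (\<rho> * (\<theta> ^ 3 - \<theta> - 1)\<^sup>2 / \<theta> ^ 3)"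
        by (simp add: power2_eq_square) algebra
      also have "\<dots> \<le> 0" using \<rho> t1 by simp
      finally show "\<rho> * ((\<theta> ^ 3 - \<theta> - 1) / \<theta> ^ 3) * (1 + \<theta> - \<theta> ^ 3) \<le> 0" .
    qed (use w t1 in auto)
    then show ?thesis using \<rho> t1 by simp
  next
    assume a3: "a3 = 2"
    define p1 p2 p3 where "p1 = \<theta> - 1" and "p2 = \<theta>\<^sup>2 - \<theta>" and "p3 = \<theta> ^ 3 - \<theta>\<^sup>2"
    have "(1 + (1 + p1)\<^sup>2 + (1 + p1 + p2)\<^sup>2 + (2 + p1 + p2 + p3)\<^sup>2 - (1 + p1\<^sup>2 + p2\<^sup>2 + p3\<^sup>2)) * \<theta> ^ 8
      \<le> (1 + (1 + p1) * \<theta> + (1 + p1 + p2) * \<theta>\<^sup>2 + (2 + p1 + p2 + p3) * \<theta> ^ 3)\<^sup>2 * w"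
      by (rule quadratic_max_le[where c = "\<rho> * (1 + p1 / \<theta> + p2 / \<theta>\<^sup>2 + p3 / \<theta> ^ 3)"])
         (use b3[of 1 p1 p2 p3] w pos t1 a0 a1 a2 a3 in simp_all)
    \<comment> \<open>The cofactor left after factoring out the quartic; each negative power is
      dominated by the next higher one.\<close>
    moreover define q where "q = 1 + \<theta>\<^sup>2 + \<theta> ^ 3 + 2 * \<theta> ^ 4 - \<theta> ^ 5 + 2 * \<theta> ^ 6 - \<theta> ^ 7 + \<theta> ^ 8 - \<theta> ^ 9 + \<theta> ^ 10"
    have "(1 + (1 + p1)\<^sup>2 + (1 + p1 + p2)\<^sup>2 + (2 + p1 + p2 + p3)\<^sup>2 - (1 + p1\<^sup>2 + p2\<^sup>2 + p3\<^sup>2)) * \<theta> ^ 8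
        - (1 + (1 + p1) * \<theta> + (1 + p1 + p2) * \<theta>\<^sup>2 + (2 + p1 + p2 + p3) * \<theta> ^ 3)\<^sup>2 * w
        = (\<theta> ^ 3 + 1 - \<theta> ^ 4) * q"
      unfolding p1_def p2_def p3_def q_def w_def by algebra
    moreover have "0 < q"
    proof -
      have "0 < \<theta> ^ 4" using pos .
      then show ?thesis unfolding q_def using grows pos[of 2] pos[of 3] pos[of 6] by linarith
    qed
    ultimately have "(\<theta> ^ 3 + 1 - \<theta> ^ 4) * q \<le> 0" by linarith
    then have "\<theta> ^ 3 + 1 - \<theta> ^ 4 \<le> 0" using \<open>0 < q\<close> by (simp add: mult_le_0_iff)
    then show ?thesis using le by simp
  qed
qed

section \<open>The cubic and quartic roots are Pisot numbers\<close>

text \<open>Negative discriminant makes the root non-real; the other root is its conjugate, and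
  their product is \<open>c\<close>.\<close>

lemma norm_root_real_quadratic:
  fixes z :: complex and b c :: real
  assumes root: "z\<^sup>2 + of_real b * z + of_real c = 0" and disc: "b\<^sup>2 < 4 * c"
  shows "(norm z)\<^sup>2 = c"
proof -
  define x y where "x = Re z" and "y = Im z"
  have re: "x\<^sup>2 - y\<^sup>2 + b * x + c = 0" and im: "y * (2 * x + b) = 0"
    using arg_cong[OF root, of Re] arg_cong[OF root, of Im]
    by (simp_all add: x_def y_def power2_eq_square algebra_simps)
  have "y \<noteq> 0"
  proof
    assume "y = 0"
    then have "(2 * x + b)\<^sup>2 = b\<^sup>2 - 4 * c" using re by (simp add: power2_eq_square algebra_simps)
    then show False using disc zero_le_power2[of "2 * x + b"] by linarith
  qed
  then have "b = - 2 * x" using im by simp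
  then have "x\<^sup>2 + y\<^sup>2 = c" using re by (simp add: power2_eq_square)
  then show ?thesis by (simp add: cmod_power2 x_def y_def)
qed

text \<open>Removing the root \<open>t\<close> leaves
  \<open>w\<^sup>2 + t * w + (t\<^sup>2 - 1)\<close>, whose roots have squared modulus
  \<open>t\<^sup>2 - 1 < 1\<close>.\<close>

lemma Pisot_cubic:
  assumes t: "1 < t" "t < 7 / 5" and root: "t ^ 3 = t + 1"
  shows "Pisot t"
proof (rule PisotI)
  have "13 / 10 < t"
  proof (rule ccontr)
    assume "\<not> 13 / 10 < t"
    then have "t * (t\<^sup>2 - 1) \<le> 13 / 10 * ((13 / 10)\<^sup>2 - 1)"
      using t by (intro mult_mono diff_right_mono power_mono) auto
    moreover have "t * (t\<^sup>2 - 1) = 1" using root by (simp add: power2_eq_square power3_eq_cube algebra_simps)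
    ultimately show False by (simp add: power2_eq_square)
  qed
  then have lower: "(13 / 10)\<^sup>2 < t\<^sup>2" by (intro power_strict_mono) auto
  have upper: "t\<^sup>2 < (7 / 5)\<^sup>2" using t by (intro power_strict_mono) auto
  show "lead_coeff [:- 1, - 1, 0, 1 :: int:] = 1" by simp
  have root': "complex_of_real t ^ 3 = of_real t + 1" using root by (metis of_real_1 of_real_add of_real_power)
  show "poly (map_poly of_int [:- 1, - 1, 0, 1:]) (complex_of_real t) = 0"
    using root' by (simp add: map_poly_pCons power3_eq_cube algebra_simps)
  fix w assume w: "poly (map_poly of_int [:- 1, - 1, 0, 1:]) w = 0" "w \<noteq> complex_of_real t"
  have "w ^ 3 = w + 1" using w(1) by (simp add: map_poly_pCons power3_eq_cube algebra_simps)
  then have "(w - of_real t) * (w\<^sup>2 + of_real t * w + of_real (t\<^sup>2 - 1)) = 0"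
    using root' by (simp add: power2_eq_square power3_eq_cube algebra_simps)
  then have "w\<^sup>2 + of_real t * w + of_real (t\<^sup>2 - 1) = 0" using w(2) by simp
  moreover have "t\<^sup>2 < 4 * (t\<^sup>2 - 1)" using lower by (simp add: power2_eq_square)
  ultimately have "(norm w)\<^sup>2 = t\<^sup>2 - 1" by (rule norm_root_real_quadratic)
  then have "(norm w)\<^sup>2 < 1" using upper by (simp add: power2_eq_square)
  then show "norm w < 1" by (simp add: abs_square_less_1)
qed fact

text \<open>Besides \<open>t\<close> there is a real root \<open>- s\<close> with
  \<open>3 / 4 \<le> s < 1\<close>. The remaining quadratic has constant term
  \<open>1 / (t * s) < 1\<close> and negative discriminant.\<close>

lemma Pisot_quartic:
  assumes t: "69 / 50 \<le> t" "t < 7 / 5" and root: "t ^ 4 = t ^ 3 + 1"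
  shows "Pisot t"
proof (rule PisotI)
  show "lead_coeff [:- 1, 0, 0, - 1, 1 :: int:] = 1" by simp
  show "1 < t" using t by simp
  have root': "complex_of_real t ^ 4 = of_real t ^ 3 + 1"
    using root by (metis of_real_1 of_real_add of_real_power)
  show "poly (map_poly of_int [:- 1, 0, 0, - 1, 1:]) (complex_of_real t) = 0"
    using root' by (simp add: map_poly_pCons eval_nat_numeral algebra_simps)
  have "\<exists>s\<ge>3 / 4. s \<le> 1 \<and> s ^ 4 + s ^ 3 = (1 :: real)"
    by (rule IVT') (auto intro!: continuous_intros simp: eval_nat_numeral)
  then obtain s where s: "3 / 4 \<le> s" "s \<le> 1" "s ^ 4 + s ^ 3 = (1 :: real)" by blast
  define u v where "u = t - s - 1" and "v = t * s + u * (t - s)"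
  \<comment> \<open>Division with a linear remainder, which vanishes at \<open>t\<close> and
    \<open>- s\<close> and is therefore zero.\<close>
  have quot: "x ^ 4 - x ^ 3 - 1 = (x - t) * (x + s) * (x\<^sup>2 + u * x + v)
      + (u * t * s + v * (t - s)) * x + (t * s * v - 1)" for x
    unfolding u_def v_def by algebra
  have "(u * t * s + v * (t - s)) * t + (t * s * v - 1) = 0"
    using quot[of t] root by simp
  moreover have "(u * t * s + v * (t - s)) * (- s) + (t * s * v - 1) = 0"
    using quot[of "- s"] s(3) by simp
  ultimately have "(u * t * s + v * (t - s)) * (t + s) = 0" by algebra
  then have lin: "u * t * s + v * (t - s) = 0" using t s by auto
  then have tsv: "t * s * v = 1" using \<open>_ * t + _ = 0\<close> by simp
  have "69 / 50 * (3 / 4) \<le> t * s" using t s by (intro mult_mono) auto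
  then have ts: "1 < t * s" by simp
  have "t * s \<le> 7 / 5 * 1" using t s by (intro mult_mono) auto
  have "t * s \<noteq> 0" using ts by auto
  then have v_eq: "v = 1 / (t * s)" using tsv by (metis nonzero_mult_div_cancel_left)
  have "v < 1" "1 / 2 < v" unfolding v_eq using ts \<open>t * s \<le> 7 / 5 * 1\<close> by (simp_all add: field_simps)
  have "u\<^sup>2 < 1" using t s by (simp add: u_def abs_square_less_1 abs_if)
  fix w assume w: "poly (map_poly of_int [:- 1, 0, 0, - 1, 1:]) w = 0" "w \<noteq> complex_of_real t"
  have "w ^ 4 - w ^ 3 - 1 = 0" using w(1) by (simp add: map_poly_pCons eval_nat_numeral algebra_simps)
  moreover have "w ^ 4 - w ^ 3 - 1 = (w - of_real t) * (w + of_real s) * (w\<^sup>2 + of_real u * w + of_real v)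
      + of_real (u * t * s + v * (t - s)) * w + of_real (t * s * v - 1)"
    unfolding u_def v_def of_real_add of_real_mult of_real_diff of_real_1 by algebra
  ultimately have "(w - of_real t) * (w + of_real s) * (w\<^sup>2 + of_real u * w + of_real v) = 0"
    unfolding lin tsv by simp
  then consider "w = - of_real s" | "w\<^sup>2 + of_real u * w + of_real v = 0"
    using w(2) by (auto simp: add_eq_0_iff2)
  then show "norm w < 1"
  proof cases
    case 1
    have "s \<noteq> 1" using s(3) by auto
    then show ?thesis using 1 s by simp
  next
    case 2
    have "u\<^sup>2 < 4 * v" using \<open>u\<^sup>2 < 1\<close> \<open>1 / 2 < v\<close> by linarith
    from norm_root_real_quadratic[OF 2 this] have "(norm w)\<^sup>2 < 1" using \<open>v < 1\<close> by simp
    then show ?thesis by (simp add: abs_square_less_1)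
  qed
qed

theorem proposition1p6:
  shows "L1 (sqrt second_smallest_Pisot) = 0"
proof -
  have "\<exists>x\<ge>69 / 50. x \<le> 139 / 100 \<and> x ^ 4 - x ^ 3 = (1 :: real)"
    by (rule IVT') (auto intro!: continuous_intros simp: eval_nat_numeral)
  then obtain \<beta> :: real where \<beta>: "69 / 50 \<le> \<beta>" "\<beta> \<le> 139 / 100" "\<beta> ^ 4 - \<beta> ^ 3 = 1" by blast
  have "\<exists>x\<ge>13 / 10. x \<le> 133 / 100 \<and> x ^ 3 - x = (1 :: real)"
    by (rule IVT') (auto intro!: continuous_intros simp: eval_nat_numeral)
  then obtain \<alpha> :: real where \<alpha>: "13 / 10 \<le> \<alpha>" "\<alpha> \<le> 133 / 100" "\<alpha> ^ 3 - \<alpha> = 1" by blast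
  have Pisot: "Pisot \<alpha>" "Pisot \<beta>"
    by (rule Pisot_cubic, use \<alpha> in auto) (rule Pisot_quartic, use \<beta> in auto)
  \<comment> \<open>Both polynomials increase beyond 1, so \<open>x \<le> \<beta>\<close> gives the
    inequality of \<open>Pisot_small_cases\<close> and each resulting equation has a single
    solution.\<close>
  have cases: "x = \<alpha> \<or> x = \<beta>" if "Pisot x" "x \<le> \<beta>" for x
  proof -
    have "1 < x" using that by (simp add: Pisot_def)
    have quartic: "y ^ 4 - y ^ 3 < z ^ 4 - z ^ 3" if "1 < y" "y < z" for y z :: real
    proof -
      have "y ^ 3 * (y - 1) < z ^ 3 * (z - 1)"
        using that by (intro mult_strict_mono power_strict_mono) auto
      then show ?thesis by (simp add: algebra_simps eval_nat_numeral)
    qed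
    have cubic: "y ^ 3 - y < z ^ 3 - z" if "1 < y" "y < z" for y z :: real
    proof -
      have "y * (y\<^sup>2 - 1) < z * (z\<^sup>2 - 1)"
        using that by (intro mult_strict_mono diff_strict_right_mono power_strict_mono) auto
      then show ?thesis by (simp add: algebra_simps eval_nat_numeral)
    qed
    have "x ^ 4 - x ^ 3 \<le> \<beta> ^ 4 - \<beta> ^ 3"
      using quartic[of x \<beta>] \<open>1 < x\<close> that(2) by (cases "x = \<beta>") auto
    then have "x ^ 4 \<le> x ^ 3 + 1" using \<beta>(3) by simp
    then have "x ^ 3 = x + 1 \<or> x ^ 4 = x ^ 3 + 1" by (rule Pisot_small_cases[OF that(1)])
    then show ?thesis
    proof
      assume "x ^ 3 = x + 1"
      then have "x = \<alpha>"
        using cubic[of x \<alpha>] cubic[of \<alpha> x] \<open>1 < x\<close> \<alpha> by (cases x \<alpha> rule: linorder_cases) auto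
      then show ?thesis ..
    next
      assume "x ^ 4 = x ^ 3 + 1"
      then have "x = \<beta>"
        using quartic[of x \<beta>] \<open>1 < x\<close> \<beta> that(2) by (cases "x = \<beta>") auto
      then show ?thesis ..
    qed
  qed
  have smallest: "smallest_Pisot = \<alpha>"
    unfolding smallest_Pisot_def
  proof (rule Least_equality)
    fix y assume "Pisot y"
    then show "\<alpha> \<le> y" using cases[of y] \<alpha> \<beta> by (cases "y \<le> \<beta>") auto
  qed (rule Pisot)
  have "second_smallest_Pisot = \<beta>"
    unfolding second_smallest_Pisot_def smallest
  proof (rule Least_equality)
    fix y assume "Pisot y \<and> y \<noteq> \<alpha>"
    then show "\<beta> \<le> y" using cases[of y] by (cases "y \<le> \<beta>") auto
  qed (use Pisot \<alpha> \<beta> in auto)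
  \<comment> \<open>The square root lies below 1.3, hence below the smallest Pisot number.\<close>
  moreover have "\<not> Pisot (sqrt \<beta>)"
  proof
    assume Pisot: "Pisot (sqrt \<beta>)"
    have "sqrt \<beta> < 13 / 10" using \<beta> by (intro real_less_lsqrt) (auto simp: power2_eq_square)
    then show False using cases[OF Pisot] \<alpha> \<beta> by auto
  qed
  moreover have "\<beta>\<^sup>2 \<le> 2"
  proof -
    have "\<beta>\<^sup>2 \<le> (139 / 100)\<^sup>2" using \<beta> by (intro power_mono) auto
    then show ?thesis by (simp add: power2_eq_square)
  qed
  ultimately show ?thesis using L1_sqrt_Pisot Pisot(2) by simp
qed

end
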